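(* $$\int_0^1\log\Gamma_3(x+1)\,dx=-\frac{1}{24}\log(2\pi)+\frac{3\varsigma(3)}{8\pi^2}.$$
   Context: $\varsigma$ is the Riemann zeta function. $\Gamma_3$ is the Barnes triple gamma function, given by $$\Gamma_3(1+x)=\exp(c_1x+c_2x^2+c_3x^3)\prod_{k=1}^{\infty}\left\{\left(1+\frac{x}{k}\right)^{-\frac12k(k+1)}\exp\left[\left(1+\frac1k\right)\left(\frac12kx-\frac14x^2+\frac{1}{6k}x^3\right)\right]\right\},$$ where $$c_1=\frac38-\frac14\log(2\pi)-\log A,\qquad c_2=\frac14\left[\gamma+\log(2\pi)+\frac12\right],\qquad c_3=-\frac16\left[\gamma+\varsigma(2)+\frac32\right],$$ $\gamma$ is Euler's constant, and $A$ is the Glaisher–Kinkelin constant, $\log A=\frac1{12}-\varsigma'(-1)$. It satisfies $\Gamma_3(1)=1$ and $\Gamma_3(x+1)=\Gamma_3(x)G(x)$, where $G$ is the Barnes $G$-function ($G(1)=1$, $G(x+1)=\Gamma(x)G(x)$). *)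

theory Defs
  imports "HOL-Complex_Analysis.Complex_Analysis"
begin

text \<open>
  The Riemann zeta function, as the holomorphic continuation of its Dirichlet series to the
  complex plane without the point 1. By the identity theorem this continuation is unique on
  that domain; the value at the pole 1 is unspecified.
\<close>
definition riemann_zeta :: "complex \<Rightarrow> complex" where
  "riemann_zeta = (SOME f. f holomorphic_on (- {1}) \<and>
     (\<forall>s. Re s > 1 \<longrightarrow> (\<lambda>n. of_nat (Suc n) powr (- s)) sums f s))"

text \<open>
  The values of zeta and of its derivative at real points other than 1 are real;
  \<open>Re\<close> only transports them to type \<open>real\<close>.
\<close>
definition glaisher_kinkelin :: real where
  "glaisher_kinkelin = exp (1 / 12 - Re (deriv riemann_zeta (- 1)))"

definition Gamma3_c1 :: real where
  "Gamma3_c1 = 3 / 8 - 1 / 4 * ln (2 * pi) - ln glaisher_kinkelin"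

definition Gamma3_c2 :: real where
  "Gamma3_c2 = 1 / 4 * (euler_mascheroni + ln (2 * pi) + 1 / 2)"

definition Gamma3_c3 :: real where
  "Gamma3_c3 = - 1 / 6 * (euler_mascheroni + Re (riemann_zeta 2) + 3 / 2)"

text \<open>
  The factor with index \<open>k \<ge> 1\<close> of the Weierstrass product for \<open>\<Gamma>\<^sub>3 (1 + x)\<close>.
  The exponent \<open>k (k + 1) / 2\<close> is an integer, so integer powers suffice.
\<close>
definition Gamma3_factor :: "'a :: {real_normed_field, banach} \<Rightarrow> nat \<Rightarrow> 'a" where
  "Gamma3_factor x k =
     (1 + x / of_nat k) powi (- int (k * (k + 1) div 2)) *
     exp ((1 + 1 / of_nat k) * (1 / 2 * of_nat k * x - 1 / 4 * x ^ 2 + 1 / (6 * of_nat k) * x ^ 3))"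

text \<open>
  Like the library's \<open>Gamma\<close>, this is available over the reals and the complex numbers,
  and takes the value 0 at the poles \<open>0, -1, -2, \<dots>\<close>.
\<close>
definition barnes_Gamma3 :: "'a :: {real_normed_field, banach} \<Rightarrow> 'a" where
  "barnes_Gamma3 z = (let x = z - 1 in
     exp (of_real Gamma3_c1 * x + of_real Gamma3_c2 * x ^ 2 + of_real Gamma3_c3 * x ^ 3) *
     (\<Prod>n. Gamma3_factor x (Suc n)))"

end

theory Submission
  imports Defs "HOL-Probability.Sinc_Integral" "HOL-Real_Asymp.Real_Asymp"
begin

text \<open>
  Write the logarithm of the \<open>k\<close>-th factor of the product as \<open>u\<^sub>k\<close>. Its series expansion in \<open>x / k\<close>
  starts in degree 4, so \<open>0 \<le> u\<^sub>k x \<le> 1 / k\<^sup>2\<close> on \<open>[0, 1]\<close> and the product may be integrated term by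
  term (\<open>has_integral_ln_barnes_Gamma3\<close>). Let \<open>B u = u (u - 1/2) (u - 1)\<close> be the third Bernoulli
  polynomial, and let \<open>J\<^sub>k\<close> be the integral of \<open>B (t - k) / t\<close> over \<open>[k, k + 1]\<close>, that is,
  \<open>J\<^sub>k = k\<^sup>2 + k + 1/12 - k (k + 1/2) (k + 1) (ln (k + 1) - ln k)\<close>. The integral of \<open>u\<^sub>k\<close> is then
  \<open>J\<^sub>k / 2 - k (k + 1) (ln (k + 1) - ln k) / 4\<close> plus rational terms. Summation by parts turns the
  second part into \<open>\<Sum>n\<le>N. n * ln n\<close>, so three limits are needed: the one defining Euler's constant,
  one for \<open>\<Sum>n\<le>N. n * ln n\<close>, and one for \<open>\<Sum>k<N. J\<^sub>k\<close>. In the total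
  (\<open>suminf_integral_ln_Gamma3_factor\<close>) everything except \<open>\<zeta>(3)\<close> cancels against the coefficients
  \<open>c\<^sub>1\<close>, \<open>c\<^sub>2\<close>, \<open>c\<^sub>3\<close>, apart from the multiple of \<open>ln (2 * pi)\<close> that these contain.

  \<^item> The limit of \<open>\<Sum>n\<le>N. n * ln n\<close>, corrected by its main terms, is \<open>ln A\<close>
    (\<open>ln_glaisher_kinkelin_LIMSEQ\<close>). The constant \<open>A\<close> is defined by \<open>\<zeta>'(-1)\<close>, so the existence of
    the continuation of \<open>\<zeta>\<close> to the plane without 1 has to be proved first. Expanding
    \<open>(n + 1)\<^sup>1\<^sup>-\<^sup>s\<close> in powers of \<open>1 / n\<close> and summing over \<open>n\<close> expresses \<open>(s - 1) \<zeta>(s)\<close> by its values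
    at \<open>s + 1, s + 2, \<dots>\<close> and a series that converges in a larger half-plane
    (\<open>zeta_recurrence\<close>); so the domain grows by a strip of width 1 at each step. The same expansion
    shows that the partial sums of the Dirichlet series with three Euler-Maclaurin corrections
    converge to \<open>\<zeta>\<close> locally uniformly for \<open>Re s > -2\<close>, \<open>s \<noteq> 1\<close>, and so do their
    derivatives to \<open>\<zeta>'\<close> (\<open>deriv_zeta_EM_tendsto\<close>).

  \<^item> The sum \<open>\<Sum>k<N. J\<^sub>k\<close> is the integral over \<open>[0, N]\<close> of the periodic continuation of \<open>B\<close> divided by
    \<open>t\<close>. By the Fourier expansion of \<open>B\<close> (\<open>sin_cubes_sums\<close>, \<open>Bernoulli3_sums\<close>) it equals
    \<open>3 / (2 * pi^3) * (\<Sum>n\<ge>1. Si (2 * pi * n * N) / n^3)\<close>, where \<open>Si\<close> is the sine integral. As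
    \<open>Si\<close> tends to \<open>pi / 2\<close>, the limit is \<open>3 * \<zeta>(3) / (4 * pi^2)\<close>
    (\<open>sum_Bernoulli3_integral_LIMSEQ\<close>).
\<close>

section \<open>Binomial expansion with remainder\<close>

text \<open>
  The error of the expansion of \<open>(n + 1) powr a\<close> in decreasing powers of \<open>n\<close>, cut off after the
  term \<open>n powr (a - J)\<close>.
\<close>
definition binomial_remainder :: "nat \<Rightarrow> complex \<Rightarrow> nat \<Rightarrow> complex" where
  "binomial_remainder J a n =
     of_nat (n + 1) powr a - (\<Sum>j\<le>J. (a gchoose j) * of_nat n powr (a - of_nat j))"

lemma one_plus_powr_Taylor_bound:
  fixes a :: complex and x :: real
  assumes "norm a \<le> B" "0 \<le> x" "x \<le> 1"
  shows "norm ((1 + of_real x) powr a - (\<Sum>j\<le>J. (a gchoose j) * of_real x ^ j)) \<le>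
           (B + real J) ^ Suc J * 2 powr B / fact J * x ^ Suc J"
proof -
  have B: "B \<ge> 0" using assms(1) norm_ge_zero order_trans by blast
  define S where "S = closed_segment (0::complex) 1"
  define f where "f = (\<lambda>i z. (\<Prod>k=0..<i. a - of_nat k) * (1 + z) powr (a - of_nat i))"
  have S_iff: "z \<in> S \<longleftrightarrow> (\<exists>y. 0 \<le> y \<and> y \<le> 1 \<and> z = of_real y)" for z :: complex
    unfolding S_def in_segment by (auto simp: scaleR_conv_of_real)
  have "norm (f 0 (of_real x) - (\<Sum>i\<le>J. f i 0 * (of_real x - 0) ^ i / fact i)) \<le>
          ((B + real J) ^ Suc J * 2 powr B) * norm (of_real x - 0 :: complex) ^ Suc J / fact J"
  proof (rule complex_Taylor[where S = S])
    show "convex S" by (simp add: S_def)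
    show "of_real x \<in> S" "0 \<in> S"
      using assms S_iff by (auto simp: S_def)
  next
    fix i z assume "z \<in> S"
    then obtain y where y: "0 \<le> y" "y \<le> 1" "z = of_real y" using S_iff by blast
    have nz: "1 + z \<notin> \<real>\<^sub>\<le>\<^sub>0" using y by (auto simp: complex_nonpos_Reals_iff)
    show "(f i has_field_derivative f (Suc i) z) (at z within S)"
      unfolding f_def
      by (rule derivative_eq_intros refl nz | (simp add: algebra_simps; fail))+
  next
    fix z assume "z \<in> S"
    then obtain y where y: "0 \<le> y" "y \<le> 1" "z = of_real y" using S_iff by blast
    have "norm (\<Prod>k=0..<Suc J. a - of_nat k) = (\<Prod>k=0..<Suc J. norm (a - of_nat k))"
      by (simp add: prod_norm)
    also have "\<dots> \<le> (\<Prod>k=0..<Suc J. B + real J)"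
    proof (rule prod_mono, safe)
      fix k assume "k \<in> {0..<Suc J}"
      have "norm (a - of_nat k) \<le> norm a + norm (of_nat k :: complex)" by (rule norm_triangle_ineq4)
      also have "\<dots> \<le> B + real J" using assms(1) \<open>k \<in> _\<close> by simp
      finally show "norm (a - of_nat k) \<le> B + real J" .
    qed auto
    finally have 1: "norm (\<Prod>k=0..<Suc J. a - of_nat k) \<le> (B + real J) ^ Suc J" by simp
    have "norm ((1 + z) powr (a - of_nat (Suc J))) = (1 + y) powr (Re a - Suc J)"
    proof -
      have "1 + z = of_real (1 + y)" using y by simp
      thus ?thesis using y by (metis norm_powr_real_powr Re_complex_of_real Reals_of_real minus_complex.sel(1) complex_Re_of_nat add_nonneg_nonneg zero_le_one)
    qed
    also have "\<dots> \<le> (1 + y) powr B"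
      using y assms(1) abs_Re_le_cmod[of a] by (intro powr_mono) auto
    also have "\<dots> \<le> 2 powr B" using y B by (intro powr_mono2) auto
    finally show "norm (f (Suc J) z) \<le> (B + real J) ^ Suc J * 2 powr B"
      unfolding f_def norm_mult using 1 B by (intro mult_mono) auto
  qed
  also have "(\<Sum>i\<le>J. f i 0 * (of_real x - 0) ^ i / fact i) = (\<Sum>j\<le>J. (a gchoose j) * of_real x ^ j)"
    by (intro sum.cong) (auto simp: f_def gbinomial_prod_rev)
  finally show ?thesis using assms by (simp add: f_def)
qed

lemma binomial_remainder_bound:
  assumes "norm a \<le> B" "n \<ge> 1"
  shows "norm (binomial_remainder J a n) \<le>
           (B + real J) ^ Suc J * 2 powr B / fact J * real n powr (Re a - real J - 1)"
proof -
  define x where "x = 1 / real n"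
  have n: "real n > 0" using assms by simp
  have x: "0 \<le> x" "x \<le> 1" using assms by (auto simp: x_def)
  have 1: "of_nat (n + 1) powr a = of_nat n powr a * (1 + of_real x) powr a"
  proof -
    have "(of_nat (n + 1) :: complex) = of_nat n * (1 + of_real x)"
      using n by (simp add: x_def field_simps)
    thus ?thesis using x powr_times_real[of "of_nat n" "1 + of_real x" a] by simp
  qed
  have 2: "of_nat n powr (a - of_nat j) = of_nat n powr a * of_real x ^ j" for j
    using n by (simp add: x_def powr_diff powr_nat' field_simps)
  have "binomial_remainder J a n =
          of_nat n powr a * ((1 + of_real x) powr a - (\<Sum>j\<le>J. (a gchoose j) * of_real x ^ j))"
    unfolding binomial_remainder_def 1 2 right_diff_distrib sum_distrib_left
    by (intro arg_cong2[where f = "(-)"] refl sum.cong) (simp add: mult_ac)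
  also have "norm \<dots> \<le> real n powr Re a * ((B + real J) ^ Suc J * 2 powr B / fact J * x ^ Suc J)"
    unfolding norm_mult using n one_plus_powr_Taylor_bound[OF assms(1) x, of J]
    by (intro mult_mono) (auto simp: norm_powr_real_powr)
  also have "\<dots> = (B + real J) ^ Suc J * 2 powr B / fact J * (real n powr Re a * x ^ Suc J)"
    by (simp only: mult_ac times_divide_eq_right times_divide_eq_left)
  also have "real n powr Re a * x ^ Suc J = real n powr (Re a - real J - 1)"
  proof -
    have "real n powr (Re a - real J - 1) = real n powr (Re a - real (Suc J))" by (simp add: algebra_simps)
    also have "\<dots> = real n powr Re a / real n ^ Suc J" using n by (simp only: powr_diff powr_realpow)
    finally show ?thesis by (simp add: x_def power_one_over divide_inverse power_inverse)
  qed
  finally show ?thesis .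
qed

lemma holomorphic_gbinomial [holomorphic_intros]:
  fixes f :: "complex \<Rightarrow> complex"
  assumes "f holomorphic_on A"
  shows "(\<lambda>s. f s gchoose k) holomorphic_on A"
  unfolding gbinomial_prod_rev using assms by (auto intro!: holomorphic_intros)

lemma binomial_remainder_holomorphic:
  assumes "n \<ge> 1" "f holomorphic_on A"
  shows "(\<lambda>s. binomial_remainder J (f s) n) holomorphic_on A"
  unfolding binomial_remainder_def using assms
  by (intro holomorphic_intros) auto

text \<open>
  The Weierstrass test for series of holomorphic functions that are dominated by a Dirichlet series,
  locally uniformly in \<open>s\<close>; it also allows differentiation term by term.
\<close>
lemma holomorphic_powr_dominated_series:
  fixes F :: "nat \<Rightarrow> complex \<Rightarrow> complex"
  assumes "open S" "\<And>n. F n holomorphic_on S"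
    and bd: "\<And>B. B > 0 \<Longrightarrow> \<exists>C. \<forall>s\<in>S. norm s \<le> B \<longrightarrow> (\<forall>n. norm (F n s) \<le> C * real (Suc n) powr (c - Re s))"
    and "\<And>s. s \<in> S \<Longrightarrow> Re s > c + 1"
  shows "(\<lambda>s. \<Sum>n. F n s) holomorphic_on S" "\<And>s. s \<in> S \<Longrightarrow> (\<lambda>n. F n s) sums (\<Sum>n. F n s)"
    "\<And>s. s \<in> S \<Longrightarrow> (\<lambda>n. deriv (F n) s) sums deriv (\<lambda>s. \<Sum>n. F n s) s"
proof -
  have "\<exists>g g'. \<forall>s\<in>S. (\<lambda>n. F n s) sums g s \<and> (\<lambda>n. deriv (F n) s) sums g' s \<and> (g has_field_derivative g' s) (at s)"
  proof (rule series_and_derivative_comparison_local[OF assms(1)])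
    fix n s assume "s \<in> S"
    thus "(F n has_field_derivative deriv (F n) s) (at s)"
      using assms holomorphic_derivI by blast
  next
    fix s assume s: "s \<in> S"
    \<comment> \<open>half the distance to the line \<open>Re s = c + 1\<close> leaves the exponent at most \<open>-1 - d\<close> on the ball\<close>
    define d where "d = (Re s - c - 1) / 2"
    have d: "d > 0" using assms(4)[OF s] by (simp add: d_def)
    obtain C where C: "\<And>t n. t \<in> S \<Longrightarrow> norm t \<le> norm s + d \<Longrightarrow> norm (F n t) \<le> C * real (Suc n) powr (c - Re t)"
      using bd[of "norm s + d"] d by (meson add_nonneg_pos norm_ge_zero)
    have "norm (F n t) \<le> \<bar>C\<bar> * real (Suc n) powr (- 1 - d)" if "t \<in> ball s d \<inter> S" for n t
    proof -
      have 1: "norm t \<le> norm s + d"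
        using that norm_triangle_sub[of t s] by (simp add: dist_norm norm_minus_commute)
      have 2: "Re t \<ge> Re s - d"
        using that abs_Re_le_cmod[of "s - t"] unfolding minus_complex.sel Int_iff mem_ball dist_norm by linarith
      have "norm (F n t) \<le> C * real (Suc n) powr (c - Re t)" using C that 1 by blast
      also have "\<dots> \<le> \<bar>C\<bar> * real (Suc n) powr (- 1 - d)"
      proof (rule mult_mono)
        show "real (Suc n) powr (c - Re t) \<le> real (Suc n) powr (- 1 - d)"
          using 2 by (intro powr_mono) (auto simp: d_def field_simps)
      qed auto
      finally show ?thesis .
    qed
    moreover have "summable (\<lambda>n. \<bar>C\<bar> * real (Suc n) powr (- 1 - d))"
      using d summable_real_powr_iff[of "-1-d"] by (intro summable_mult) (subst summable_Suc_iff, simp)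
    ultimately show "\<exists>d h. 0 < d \<and> summable h \<and> (\<forall>\<^sub>F n in sequentially. \<forall>y\<in>ball s d \<inter> S. norm (F n y) \<le> h n)"
      using d by (intro exI[of _ d] exI[of _ "\<lambda>n. \<bar>C\<bar> * real (Suc n) powr (- 1 - d)"]) auto
  qed
  then obtain g g' where g: "\<And>s. s \<in> S \<Longrightarrow> (\<lambda>n. F n s) sums g s"
     "\<And>s. s \<in> S \<Longrightarrow> (\<lambda>n. deriv (F n) s) sums g' s" "\<And>s. s \<in> S \<Longrightarrow> (g has_field_derivative g' s) (at s)"
    by metis
  have eq: "(\<Sum>n. F n s) = g s" if "s \<in> S" for s using g(1)[OF that] sums_unique by metis
  have der: "((\<lambda>s. \<Sum>n. F n s) has_field_derivative g' s) (at s)" if "s \<in> S" for s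
    using has_field_derivative_transform_within_open[OF g(3)[OF that] assms(1) that] eq by metis
  show "(\<lambda>s. \<Sum>n. F n s) holomorphic_on S"
    using der assms(1) by (auto simp: holomorphic_on_open)
  show "(\<lambda>n. F n s) sums (\<Sum>n. F n s)" if "s \<in> S" for s using g(1)[OF that] eq[OF that] by simp
  show "(\<lambda>n. deriv (F n) s) sums deriv (\<lambda>s. \<Sum>n. F n s) s" if "s \<in> S" for s
    using g(2)[OF that] DERIV_imp_deriv[OF der[OF that]] by simp
qed

section \<open>Continuation of the zeta function\<close>

text \<open>
  A holomorphic continuation of \<open>(s - 1) * \<zeta>(s)\<close> to the half-plane \<open>Re s > c\<close>. The factor \<open>s - 1\<close>
  removes the pole, so the induction on the half-plane need not exclude any point.
\<close>
definition is_zeta_continuation :: "real \<Rightarrow> (complex \<Rightarrow> complex) \<Rightarrow> bool" where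
  "is_zeta_continuation c g \<longleftrightarrow> g holomorphic_on {s. Re s > c} \<and>
     (\<forall>s. Re s > 1 \<longrightarrow> (\<lambda>n. of_nat (Suc n) powr (- s)) sums (g s / (s - 1)))"

lemma zeta_series_holomorphic:
  shows "(\<lambda>s. \<Sum>n. of_nat (Suc n) powr (- s)) holomorphic_on {s. Re s > 1}" (is ?A)
    and "Re s > 1 \<Longrightarrow> (\<lambda>n. of_nat (Suc n) powr (- s)) sums (\<Sum>n. of_nat (Suc n) powr (- s))"
proof -
  have op: "open {s. Re s > 1}" by (rule open_halfspace_Re_gt)
  have hol: "(\<lambda>s. of_nat (Suc n) powr (- s)) holomorphic_on {s. Re s > 1}" for n
    by (intro holomorphic_intros)
  have bd: "\<exists>C. \<forall>s\<in>{s. Re s > 1}. norm s \<le> B \<longrightarrow> (\<forall>n. norm (of_nat (Suc n) powr (- s)) \<le> C * real (Suc n) powr (0 - Re s))" for B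
    by (rule exI[of _ 1]) (simp add: norm_powr_real_powr del: of_nat_Suc)
  note * = holomorphic_powr_dominated_series[where c = 0, OF op hol bd]
  show ?A by (rule *(1)) auto
  show "(\<lambda>n. of_nat (Suc n) powr (- s)) sums (\<Sum>n. of_nat (Suc n) powr (- s))" if "Re s > 1"
    by (rule *(2)) (use that in auto)
qed

text \<open>
  Obtained by summing the expansion of \<open>(n + 1) powr (1 - s) - n powr (1 - s)\<close> over \<open>n\<close>: the left side
  telescopes to \<open>-1\<close>, and the term of index \<open>j\<close> contributes \<open>\<zeta>(s + j - 1)\<close>. The pole of that
  value at \<open>s = 2 - j\<close> is cancelled by the last factor of \<open>(1 - s) gchoose j\<close>, which leaves a
  formula free of poles, with \<open>g\<close> evaluated at points to the right of \<open>s\<close> only.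
\<close>
lemma zeta_recurrence:
  fixes s :: complex
  assumes s: "Re s > 1" and J: "J \<ge> 1" and R: "(\<lambda>n. binomial_remainder J (1 - s) (Suc n)) sums r"
    and g: "\<And>s. Re s > 1 \<Longrightarrow> (\<lambda>n. of_nat (Suc n) powr (- s)) sums (g s / (s - 1))"
  shows "g s = 1 + r - (\<Sum>j=2..J. ((1 - s) gchoose (j - 1)) / of_nat j * g (s + of_nat j - 1))"
proof -
  define D where "D = (\<lambda>n. of_nat (Suc (Suc n)) powr (1 - s) - of_nat (Suc n) powr (1 - s))"
  have "(\<lambda>n. of_nat (Suc n) powr (1 - s)) \<longlonglongrightarrow> (0::complex)"
    using s by (intro tendsto_neg_powr_complex_of_nat filterlim_Suc) auto
  hence D: "D sums (0 - of_nat (Suc 0) powr (1 - s))"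
    unfolding D_def by (rule telescope_sums)
  have split: "{..J} = insert 0 (insert (Suc 0) {2..J})" using J by auto
  have Dn: "D n = binomial_remainder J (1 - s) (Suc n) + (1 - s) * of_nat (Suc n) powr (- s) +
     (\<Sum>j=2..J. ((1 - s) gchoose j) * of_nat (Suc n) powr (- (s + of_nat j - 1)))" for n
  proof -
    have "(\<Sum>j=2..J. ((1 - s) gchoose j) * of_nat (Suc n) powr (1 - s - of_nat j)) =
          (\<Sum>j=2..J. ((1 - s) gchoose j) * of_nat (Suc n) powr (- (s + of_nat j - 1)))"
      by (intro sum.cong) (auto simp: algebra_simps)
    moreover have "(of_nat (Suc n) :: complex) powr (1 - s - of_nat (Suc 0)) = of_nat (Suc n) powr (- s)"
      by (rule arg_cong) simp
    ultimately show ?thesis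
      unfolding D_def binomial_remainder_def split by (simp del: of_nat_Suc)
  qed
  have "D sums (r + (1 - s) * (g s / (s - 1)) +
     (\<Sum>j=2..J. ((1 - s) gchoose j) * (g (s + of_nat j - 1) / (s + of_nat j - 1 - 1))))"
    unfolding Dn by (intro sums_add R sums_mult sums_sum g) (use s in auto)
  from sums_unique2[OF this D]
  have "r + (1 - s) * (g s / (s - 1)) +
     (\<Sum>j=2..J. ((1 - s) gchoose j) * (g (s + of_nat j - 1) / (s + of_nat j - 1 - 1))) = -1" by simp
  moreover have "(1 - s) * (g s / (s - 1)) = - g s"
  proof -
    have "s - 1 \<noteq> 0" using s by auto
    thus ?thesis by (simp add: divide_simps) (simp add: algebra_simps)
  qed
  moreover have "((1 - s) gchoose j) * (g (s + of_nat j - 1) / (s + of_nat j - 1 - 1)) =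
    - (((1 - s) gchoose (j - 1)) / of_nat j * g (s + of_nat j - 1))" if j: "j \<in> {2..J}" for j
  proof -
    obtain i where i: "j = Suc i" using j by (cases j) auto
    have "Re (s + of_nat j - 1 - 1) > 0" using s j by auto
    hence nz: "s + of_nat j - 1 - 1 \<noteq> 0" by (metis less_irrefl zero_complex.sel(1))
    have "of_nat j * ((1 - s) gchoose j) = (1 - s - of_nat i) * ((1 - s) gchoose i)"
      unfolding i using gbinomial_mult_1[of "1 - s" i] by (simp add: algebra_simps)
    hence eq: "((1 - s) gchoose j) = - (s + of_nat j - 1 - 1) * ((1 - s) gchoose (j - 1)) / of_nat j"
      unfolding i by (subst nonzero_eq_divide_eq) (simp_all add: mult.commute del: of_nat_Suc, simp add: algebra_simps)
    have "(- X * b / c) * (G / X) = - (b / c * G)" if "X \<noteq> 0" for X b c G :: complex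
      using that by simp
    from this[OF nz] show ?thesis unfolding eq .
  qed
  ultimately have "r - g s - (\<Sum>j=2..J. ((1 - s) gchoose (j - 1)) / of_nat j * g (s + of_nat j - 1)) = -1"
    by (simp add: sum_negf)
  thus ?thesis by (simp add: algebra_simps eq_diff_eq)
qed

lemma is_zeta_continuation_step:
  assumes "is_zeta_continuation (1 - real m) g"
  shows "\<exists>h. is_zeta_continuation (1 - real (Suc m)) h"
proof -
  \<comment> \<open>the remainders are of order \<open>n powr (- Re s - J)\<close>, and \<open>Re s + J > 1\<close> is needed for \<open>Re s > - m\<close>\<close>
  define J where "J = m + 1"
  define S where "S = {s. Re s > 1 - real (Suc m)}"
  define h where "h = (\<lambda>s. 1 + (\<Sum>n. binomial_remainder J (1 - s) (Suc n)) -
     (\<Sum>j=2..J. ((1 - s) gchoose (j - 1)) / of_nat j * g (s + of_nat j - 1)))"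
  have g: "g holomorphic_on {s. Re s > 1 - real m}"
    "\<And>s. Re s > 1 \<Longrightarrow> (\<lambda>n. of_nat (Suc n) powr (- s)) sums (g s / (s - 1))"
    using assms unfolding is_zeta_continuation_def by auto
  have op: "open S" unfolding S_def by (rule open_halfspace_Re_gt)
  have hol: "(\<lambda>s. binomial_remainder J (1 - s) (Suc n)) holomorphic_on S" for n
    by (intro binomial_remainder_holomorphic holomorphic_intros) auto
  have bd: "\<exists>C. \<forall>s\<in>S. norm s \<le> B \<longrightarrow> (\<forall>n. norm (binomial_remainder J (1 - s) (Suc n)) \<le>
              C * real (Suc n) powr (- real J - Re s))" for B
  proof (rule exI, safe)
    fix s :: complex and n assume "norm s \<le> B"
    hence "norm (1 - s) \<le> 1 + B" using norm_triangle_ineq4[of 1 s] by simp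
    moreover have "Re (1 - s) - real J - 1 = - real J - Re s" by simp
    ultimately
    show "norm (binomial_remainder J (1 - s) (Suc n)) \<le>
      ((1 + B) + real J) ^ Suc J * 2 powr (1 + B) / fact J * real (Suc n) powr (- real J - Re s)"
      using binomial_remainder_bound[of "1 - s" "1 + B" "Suc n" J] by (simp only: le_add2 Suc_eq_plus1)
  qed
  have re: "Re s > - real J + 1" if "s \<in> S" for s using that by (simp add: S_def J_def)
  note ser = holomorphic_powr_dominated_series[where c = "- real J", OF op hol bd re]
  have "h holomorphic_on S"
    unfolding h_def
  proof (intro holomorphic_intros ser(1))
    fix j assume "j \<in> {2..J}"
    thus "(\<lambda>s. g (s + of_nat j - 1)) holomorphic_on S"
      by (intro holomorphic_on_compose_gen[OF _ g(1), of "\<lambda>s. s + of_nat j - 1", unfolded o_def] holomorphic_intros)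
         (auto simp: S_def)
  qed auto
  moreover have "(\<lambda>n. of_nat (Suc n) powr (- s)) sums (h s / (s - 1))" if s: "Re s > 1" for s
  proof -
    have "s \<in> S" using s by (simp add: S_def)
    have "h s = g s" unfolding h_def
      by (rule zeta_recurrence[symmetric]) (use s g(2) ser(2)[OF _ \<open>s \<in> S\<close>] in \<open>auto simp: J_def\<close>)
    thus ?thesis using g(2)[OF s] by simp
  qed
  ultimately show ?thesis unfolding is_zeta_continuation_def S_def by blast
qed

lemma ex_zeta_continuation_halfplane: "\<exists>g. is_zeta_continuation (1 - real m) g"
proof (induction m)
  case 0
  have "is_zeta_continuation 1 (\<lambda>s. (s - 1) * (\<Sum>n. of_nat (Suc n) powr (- s)))"
    unfolding is_zeta_continuation_def
    using zeta_series_holomorphic by (auto intro!: holomorphic_intros)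
  thus ?case by auto
next
  case (Suc m)
  thus ?case using is_zeta_continuation_step by blast
qed

lemma is_zeta_continuation_unique:
  assumes "is_zeta_continuation b g" "is_zeta_continuation c h" "b \<le> 1" "c \<le> 1" "Re s > b" "Re s > c"
  shows "g s = h s"
proof (rule analytic_continuation_open[of "{s. Re s > 1}" "{s. Re s > max b c}" g h])
  show "open {s. Re s > max b c}" "connected {s. Re s > max b c}"
    by (rule open_halfspace_Re_gt, rule convex_connected[OF convex_halfspace_Re_gt])
  show "{s. Re s > 1} \<noteq> {}" by (auto intro!: exI[of _ 2])
  show "g holomorphic_on {s. Re s > max b c}" "h holomorphic_on {s. Re s > max b c}"
    using assms unfolding is_zeta_continuation_def by (auto elim!: holomorphic_on_subset)
  fix z assume z: "z \<in> {s. Re s > 1}"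
  hence "g z / (z - 1) = h z / (z - 1)"
    using assms sums_unique2 unfolding is_zeta_continuation_def by blast
  thus "g z = h z" using z by auto
qed (use assms in \<open>auto intro: open_halfspace_Re_gt\<close>)

lemma ex_zeta_continuation:
  "\<exists>f. f holomorphic_on (- {1}) \<and> (\<forall>s. Re s > 1 \<longrightarrow> (\<lambda>n. of_nat (Suc n) powr (- s)) sums f s)"
proof -
  obtain g where g: "\<And>m. is_zeta_continuation (1 - real m) (g m)"
    using ex_zeta_continuation_halfplane by metis
  \<comment> \<open>by uniqueness it does not matter which of the half-planes containing \<open>s\<close> is used\<close>
  define G where "G = (\<lambda>s. g (nat \<lceil>1 - Re s\<rceil> + 1) s)"
  have G: "G s = g m s" if "Re s > 1 - real m" for s m
    unfolding G_def by (rule is_zeta_continuation_unique[OF g g]) (use that in \<open>auto, linarith\<close>)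
  have "G field_differentiable (at s)" for s
  proof -
    obtain m where m: "real m > 1 - Re s" using reals_Archimedean2 by blast
    have op: "open {s. Re s > 1 - real m}" by (rule open_halfspace_Re_gt)
    have "G holomorphic_on {s. Re s > 1 - real m}"
      using g[of m] G holomorphic_cong[OF refl, of "{s. Re s > 1 - real m}" G "g m"]
      unfolding is_zeta_continuation_def by auto
    thus ?thesis using m holomorphic_on_imp_differentiable_at[OF _ op, of G s] by auto
  qed
  hence hol: "G holomorphic_on UNIV"
    by (auto simp: holomorphic_on_def field_differentiable_at_within)
  have "(\<lambda>s. G s / (s - 1)) holomorphic_on (- {1})"
    by (intro holomorphic_intros holomorphic_on_subset[OF hol]) auto
  moreover have "(\<lambda>n. of_nat (Suc n) powr (- s)) sums (G s / (s - 1))" if "Re s > 1" for s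
    using g[of 0] G[of 0 s] that unfolding is_zeta_continuation_def by auto
  ultimately show ?thesis by blast
qed

lemma riemann_zeta_holomorphic: "riemann_zeta holomorphic_on (- {1})"
  and riemann_zeta_sums: "Re s > 1 \<Longrightarrow> (\<lambda>n. of_nat (Suc n) powr (- s)) sums riemann_zeta s"
  using someI_ex[OF ex_zeta_continuation] unfolding riemann_zeta_def by auto

lemma Re_riemann_zeta_sums:
  assumes "k \<ge> 2"
  shows "(\<lambda>n. 1 / real (Suc n) ^ k) sums Re (riemann_zeta (of_nat k))"
proof -
  have "(\<lambda>n. Re (of_nat (Suc n) powr (- of_nat k))) sums Re (riemann_zeta (of_nat k))"
    using assms by (intro sums_Re riemann_zeta_sums) auto
  moreover have "Re (of_nat (Suc n) powr (- of_nat k)) = 1 / real (Suc n) ^ k" for n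
  proof -
    have "(of_nat (Suc n) :: complex) powr (- of_nat k) = of_real (1 / real (Suc n) ^ k)"
      by (simp add: powr_minus powr_nat' divide_inverse del: of_nat_Suc)
    thus ?thesis by (metis Re_complex_of_real)
  qed
  ultimately show ?thesis by simp
qed

section \<open>The Glaisher-Kinkelin constant as a limit\<close>

text \<open>
  The partial sum of the Dirichlet series with the first three correction terms of the
  Euler-Maclaurin formula. Its increments are of order \<open>N powr (- Re s - 3)\<close>, which is summable for
  \<open>Re s > -2\<close>.
\<close>
definition zeta_EM :: "nat \<Rightarrow> complex \<Rightarrow> complex" where
  "zeta_EM N s = (\<Sum>n=1..N. of_nat n powr (- s)) - of_nat N powr (1 - s) / (1 - s)
     - of_nat N powr (- s) / 2 + s * of_nat N powr (- s - 1) / 12"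

text \<open>
  The correction terms are chosen so that the main terms of the three expansions cancel.
\<close>
lemma zeta_EM_diff:
  assumes "n \<ge> 1" "s \<noteq> 1"
  shows "zeta_EM (n + 1) s - zeta_EM n s =
           binomial_remainder 2 (- s) n / 2 - binomial_remainder 3 (1 - s) n / (1 - s)
             + s * binomial_remainder 1 (- s - 1) n / 12"
proof -
  have n: "(of_nat n :: complex) \<noteq> 0" using assms by simp
  have g2: "a gchoose 2 = a * (a - 1) / 2" for a :: complex
    by (simp add: gbinomial_prod_rev numeral_2_eq_2)
  have g3: "a gchoose 3 = a * (a - 1) * (a - 2) / 6" for a :: complex
    by (simp add: gbinomial_prod_rev numeral_3_eq_3 fact_numeral)
  have s2: "(\<Sum>j\<le>2. f j) = f 0 + f 1 + f (2::nat)" for f :: "nat \<Rightarrow> complex"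
    by (simp add: numeral_2_eq_2)
  have s3: "(\<Sum>j\<le>3. f j) = f 0 + f 1 + f 2 + f (3::nat)" for f :: "nat \<Rightarrow> complex"
    by (simp add: numeral_3_eq_3 numeral_2_eq_2)
  have s1: "(\<Sum>j\<le>1. f j) = f 0 + f (1::nat)" for f :: "nat \<Rightarrow> complex" by simp
  define P z Q0 Q1 Q2 where "P = of_nat n powr (- s)" and "z = (1 / of_nat n :: complex)"
    and "Q0 = of_nat (n + 1) powr (- s)" and "Q1 = of_nat (n + 1) powr (1 - s)"
    and "Q2 = of_nat (n + 1) powr (- s - 1)"
  have p: "of_nat n powr (- s) = P" "of_nat n powr (1 - s) = P / z"
    "of_nat n powr (1 - s - 1) = P" "of_nat n powr (1 - s - 2) = P * z" "of_nat n powr (1 - s - 3) = P * z ^ 2"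
    "of_nat n powr (- s - 1) = P * z" "of_nat n powr (- s - 2) = P * z ^ 2"
    "of_nat n powr (- s - 1 - 1) = P * z ^ 2"
    using n unfolding P_def z_def
    by (simp_all add: powr_diff powr_minus powr_nat' field_simps power2_eq_square power3_eq_cube powr_numeral)
  have z: "z \<noteq> 0" using n by (simp add: z_def)
  have s: "1 - s \<noteq> 0" using assms by simp
  have "zeta_EM (n + 1) s - zeta_EM n s =
          Q0 - (Q1 - P / z) / (1 - s) - (Q0 - P) / 2 + s * (Q2 - P * z) / 12"
    unfolding zeta_EM_def p Q0_def[symmetric] Q1_def[symmetric] Q2_def[symmetric]
    by (simp add: Q0_def Q1_def Q2_def diff_divide_distrib right_diff_distrib)
  also have "\<dots> = (Q0 - (P + (- s) * (P * z) + (- s) * (- s - 1) / 2 * (P * z ^ 2))) / 2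
     - (Q1 / (1 - s) - P / z / (1 - s) - P + s / 2 * (P * z) - s * (s + 1) / 6 * (P * z ^ 2))
     + s * (Q2 - (P * z + (- s - 1) * (P * z ^ 2))) / 12"
    unfolding diff_divide_distrib[of Q1 "P / z"]
    by (simp add: algebra_simps diff_divide_distrib add_divide_distrib)
  also have "Q1 / (1 - s) - P / z / (1 - s) - P + s / 2 * (P * z) - s * (s + 1) / 6 * (P * z ^ 2) =
     (Q1 - (P / z + (1 - s) * P + (1 - s) * (1 - s - 1) / 2 * (P * z) +
        (1 - s) * (1 - s - 1) * (1 - s - 2) / 6 * (P * z ^ 2))) / (1 - s)"
  proof -
    have gen: "(A - (C + w * a + w * b / 2 * c + w * b * d / 6 * e)) / w = A / w - C / w - a - b / 2 * c - b * d / 6 * e"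
      if "w \<noteq> 0" for A C a b c d e w :: complex
      using that by (simp add: diff_divide_distrib add_divide_distrib)
    show ?thesis unfolding gen[OF s] by (simp add: algebra_simps)
  qed
  also have "(Q0 - (P + (- s) * (P * z) + (- s) * (- s - 1) / 2 * (P * z ^ 2))) / 2 - \<dots>
     + s * (Q2 - (P * z + (- s - 1) * (P * z ^ 2))) / 12 = binomial_remainder 2 (- s) n / 2 - binomial_remainder 3 (1 - s) n / (1 - s)
             + s * binomial_remainder 1 (- s - 1) n / 12"
    unfolding binomial_remainder_def s1 s2 s3 gbinomial_1 gbinomial_0 g2 g3 of_nat_0 of_nat_1 of_nat_numeral
      diff_0_right p Q0_def[symmetric] Q1_def[symmetric] Q2_def[symmetric] by simp
  finally show ?thesis .
qed

lemma zeta_EM_holomorphic: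
  assumes "N \<ge> 1" "1 \<notin> A"
  shows "zeta_EM N holomorphic_on A"
  unfolding zeta_EM_def using assms by (intro holomorphic_intros) auto

lemma zeta_EM_tendsto_of_gt_1:
  assumes "Re s > 1"
  shows "(\<lambda>N. zeta_EM (Suc N) s) \<longlonglongrightarrow> riemann_zeta s"
proof -
  have 1: "(\<lambda>N. \<Sum>n=1..Suc N. (of_nat n :: complex) powr (- s)) \<longlonglongrightarrow> riemann_zeta s"
    using LIMSEQ_Suc[OF riemann_zeta_sums[OF assms, unfolded sums_def]]
    by (simp only: sum.atLeast1_atMost_eq One_nat_def)
  have 2: "(\<lambda>N. of_nat (Suc N) powr z) \<longlonglongrightarrow> (0::complex)" if "Re z < 0" for z
    using that by (intro tendsto_neg_powr_complex_of_nat filterlim_Suc) auto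
  have "(\<lambda>N. zeta_EM (Suc N) s) \<longlonglongrightarrow> riemann_zeta s - 0 / (1 - s) - 0 / 2 + s * 0 / 12"
    unfolding zeta_EM_def using assms by (intro tendsto_intros 1 2) auto
  thus ?thesis by simp
qed

lemma deriv_zeta_EM_tendsto:
  assumes s: "Re s > -2" "s \<noteq> 1"
  shows "(\<lambda>N. deriv (zeta_EM (Suc N)) s) \<longlonglongrightarrow> deriv riemann_zeta s"
proof -
  define S where "S = {s. Re s > -2}"
  \<comment> \<open>the increments, multiplied by \<open>1 - s\<close> to remove their pole\<close>
  define F where "F = (\<lambda>n s. (1 - s) * binomial_remainder 2 (- s) (Suc n) / 2
     - binomial_remainder 3 (1 - s) (Suc n) + (1 - s) * s * binomial_remainder 1 (- s - 1) (Suc n) / 12)"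
  define H where "H = (\<lambda>s. \<Sum>n. F n s)"
  define Z where "Z = (\<lambda>s. zeta_EM 1 s + H s / (1 - s))"
  have op: "open S" unfolding S_def by (rule open_halfspace_Re_gt)
  have hol: "F n holomorphic_on S" for n
    unfolding F_def by (intro holomorphic_intros binomial_remainder_holomorphic) auto
  have bd: "\<exists>C. \<forall>s\<in>S. norm s \<le> B \<longrightarrow> (\<forall>n. norm (F n s) \<le> C * real (Suc n) powr (-3 - Re s))" if B: "B > 0" for B
  proof -
    define K where "K = (\<lambda>J. (B + 2 + real J) ^ Suc J * 2 powr (B + 2) / fact J)"
    define C where "C = (1 + B) * K 2 / 2 + K 3 + (1 + B) * B * K 1 / 12"
    have K: "K J \<ge> 0" for J using B by (simp add: K_def)
    have "norm (F n s) \<le> C * real (Suc n) powr (-3 - Re s)" if sB: "norm s \<le> B" for s n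
    proof -
      define q where "q = real (Suc n) powr (-3 - Re s)"
      have nrm: "norm (- s) \<le> B + 2" "norm (1 - s) \<le> B + 2" "norm (- s - 1) \<le> B + 2" "norm (1 - s) \<le> 1 + B"
        using sB norm_triangle_ineq4[of 1 s] norm_triangle_ineq4[of "- s" 1] by simp_all
      have e: "Re (- s) - real 2 - 1 = -3 - Re s" "Re (1 - s) - real 3 - 1 = -3 - Re s"
        "Re (- s - 1) - real 1 - 1 = -3 - Re s" by simp_all
      have n: "1 \<le> Suc n" by simp
      have 1: "norm (binomial_remainder 2 (- s) (Suc n)) \<le> K 2 * q"
        using binomial_remainder_bound[OF nrm(1) n, of 2] by (simp only: K_def q_def e)
      have 2: "norm (binomial_remainder 3 (1 - s) (Suc n)) \<le> K 3 * q"
        using binomial_remainder_bound[OF nrm(2) n, of 3] by (simp only: K_def q_def e)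
      have 3: "norm (binomial_remainder 1 (- s - 1) (Suc n)) \<le> K 1 * q"
        using binomial_remainder_bound[OF nrm(3) n, of 1] by (simp only: K_def q_def e)
      have "norm (F n s) \<le> norm ((1 - s) * binomial_remainder 2 (- s) (Suc n) / 2)
          + norm (binomial_remainder 3 (1 - s) (Suc n))
          + norm ((1 - s) * s * binomial_remainder 1 (- s - 1) (Suc n) / 12)"
        unfolding F_def by (intro order_trans[OF norm_triangle_ineq] add_mono norm_triangle_ineq4) auto
      also have "\<dots> \<le> (1 + B) * (K 2 * q) / 2 + K 3 * q + (1 + B) * B * (K 1 * q) / 12"
        unfolding norm_mult norm_divide norm_numeral
        using 1 2 3 nrm(4) sB B by (intro add_mono divide_right_mono mult_mono) auto
      finally show ?thesis unfolding q_def[symmetric] C_def by (simp add: algebra_simps)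
    qed
    thus ?thesis by blast
  qed
  have re: "Re s > -3 + 1" if "s \<in> S" for s using that by (simp add: S_def)
  note ser = holomorphic_powr_dominated_series[where c = "-3", OF op hol bd re]
  have F: "F n t = (1 - t) * (zeta_EM (Suc (Suc n)) t - zeta_EM (Suc n) t)" if "t \<noteq> 1" for n t
    using zeta_EM_diff[of "Suc n" t] that unfolding F_def by (simp add: divide_simps) (simp add: algebra_simps)
  have EM: "zeta_EM (Suc N) t = zeta_EM 1 t + (\<Sum>n<N. F n t) / (1 - t)" if "t \<noteq> 1" for N t
  proof -
    have "(\<Sum>n<N. F n t) = (1 - t) * (\<Sum>n<N. zeta_EM (Suc (Suc n)) t - zeta_EM (Suc n) t)"
      using F[OF that] by (simp add: sum_distrib_left)
    also have "\<dots> = (1 - t) * (zeta_EM (Suc N) t - zeta_EM 1 t)"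
      by (subst sum_lessThan_telescope) simp
    finally show ?thesis using that by (simp add: field_simps)
  qed
  have Z: "(\<lambda>N. zeta_EM (Suc N) t) \<longlonglongrightarrow> Z t" if "t \<in> S" "t \<noteq> 1" for t
    unfolding EM[OF that(2)] Z_def H_def
    by (intro tendsto_intros ser(2)[unfolded sums_def] that) (use that in auto)
  have holH: "H holomorphic_on S" unfolding H_def by (rule ser(1))
  have holZ: "Z holomorphic_on S - {1}"
    unfolding Z_def by (intro holomorphic_intros zeta_EM_holomorphic holomorphic_on_subset[OF holH]) auto
  have conn: "connected (S - {1})"
    using op by (intro connected_open_delete) (auto simp: S_def intro: convex_connected convex_halfspace_Re_gt)
  \<comment> \<open>both sides are the sum of the Dirichlet series for \<open>Re s > 1\<close>\<close>
  have eq: "riemann_zeta t = Z t" if "t \<in> S" "t \<noteq> 1" for t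
  proof (rule analytic_continuation_open[of "{s. Re s > 1}" "S - {1}" riemann_zeta Z])
    show "{s. Re s > 1} \<noteq> {}" by (auto intro!: exI[of _ 2])
    show "riemann_zeta holomorphic_on S - {1}"
      by (rule holomorphic_on_subset[OF riemann_zeta_holomorphic]) auto
    show "riemann_zeta z = Z z" if "z \<in> {s. Re s > 1}" for z
    proof -
      have "z \<in> S" "z \<noteq> 1" using that by (auto simp: S_def)
      thus ?thesis using zeta_EM_tendsto_of_gt_1[of z] Z[of z] that LIMSEQ_unique by auto
    qed
    show "{s. Re s > 1} \<subseteq> S - {1}" by (auto simp: S_def)
  qed (use op conn holZ that in \<open>auto intro: open_halfspace_Re_gt\<close>)
  have sS: "s \<in> S" using s by (simp add: S_def)
  have nz: "1 - s \<noteq> 0" using s by simp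
  have op': "open (S - {1})" "s \<in> S - {1}" using op sS s by auto
  have E1: "(zeta_EM 1 has_field_derivative deriv (zeta_EM 1) s) (at s)"
    using op' by (intro holomorphic_derivI[of _ "S - {1}"] zeta_EM_holomorphic) auto
  have derEM: "deriv (zeta_EM (Suc N)) s =
      deriv (zeta_EM 1) s + ((\<Sum>n<N. deriv (F n) s) * (1 - s) + (\<Sum>n<N. F n s)) / (1 - s)^2" for N
  proof -
    have "((\<lambda>t. zeta_EM 1 t + (\<Sum>n<N. F n t) / (1 - t)) has_field_derivative
       deriv (zeta_EM 1) s + ((\<Sum>n<N. deriv (F n) s) * (1 - s) + (\<Sum>n<N. F n s)) / (1 - s)^2) (at s)"
      unfolding power2_eq_square
      by (rule DERIV_cong[OF DERIV_add[OF E1 DERIV_divide[OF DERIV_sum[OF holomorphic_derivI[OF hol op sS]]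
            DERIV_diff[OF DERIV_const DERIV_ident] nz]]]) simp
    hence "(zeta_EM (Suc N) has_field_derivative
       deriv (zeta_EM 1) s + ((\<Sum>n<N. deriv (F n) s) * (1 - s) + (\<Sum>n<N. F n s)) / (1 - s)^2) (at s)"
      by (rule has_field_derivative_transform_within_open[OF _ op'(1,2)]) (rule EM[symmetric], simp)
    thus ?thesis by (rule DERIV_imp_deriv)
  qed
  have "(Z has_field_derivative deriv (zeta_EM 1) s + (deriv H s * (1 - s) + H s) / (1 - s)^2) (at s)"
    unfolding Z_def
    unfolding power2_eq_square
    by (rule DERIV_cong[OF DERIV_add[OF E1 DERIV_divide[OF holomorphic_derivI[OF holH op sS]
          DERIV_diff[OF DERIV_const DERIV_ident] nz]]]) simp
  hence "(riemann_zeta has_field_derivative deriv (zeta_EM 1) s + (deriv H s * (1 - s) + H s) / (1 - s)^2) (at s)"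
    by (rule has_field_derivative_transform_within_open[OF _ op'(1,2)]) (use eq in auto)
  hence derz: "deriv riemann_zeta s = deriv (zeta_EM 1) s + (deriv H s * (1 - s) + H s) / (1 - s)^2"
    by (rule DERIV_imp_deriv)
  show "(\<lambda>N. deriv (zeta_EM (Suc N)) s) \<longlonglongrightarrow> deriv riemann_zeta s"
    unfolding derEM derz H_def
    by (intro tendsto_intros ser(2)[unfolded sums_def] ser(3)[unfolded sums_def] sS) (use nz in auto)
qed

lemma has_field_derivative_of_nat_powr:
  fixes f :: "complex \<Rightarrow> complex"
  assumes "n \<ge> 1" "(f has_field_derivative f') (at s)"
  shows "((\<lambda>s. of_nat n powr f s) has_field_derivative of_real (ln (real n)) * of_nat n powr f s * f') (at s)"
proof -
  have "Ln (of_nat n) = of_real (ln (real n))" using assms(1) Ln_of_real[of "real n"] by simp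
  thus ?thesis
    using DERIV_chain2[OF has_field_derivative_powr_right[of "of_nat n" "f s"] assms(2)] assms(1) by simp
qed

lemma deriv_zeta_EM_minus_1:
  assumes "N \<ge> 1"
  shows "deriv (zeta_EM N) (- 1) = of_real (- (\<Sum>n=1..N. real n * ln (real n))
     + (real N ^ 2 / 2 + real N / 2 + 1 / 12) * ln (real N) - real N ^ 2 / 4 + 1 / 12)"
proof -
  have N: "(of_nat N :: complex) \<noteq> 0" using assms by simp
  have "((\<lambda>s. of_nat n powr (- s)) has_field_derivative of_real (ln (real n)) * of_nat n powr (- (- 1)) * (- 1)) (at (- 1 :: complex))"
    if "n \<ge> 1" for n :: nat
    by (rule has_field_derivative_of_nat_powr) (use that in \<open>auto intro!: derivative_eq_intros\<close>)
  hence *: "((\<lambda>s. of_nat n powr (- s)) has_field_derivative - of_nat n * of_real (ln (real n))) (at (- 1 :: complex))"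
    if "n \<ge> 1" for n :: nat
    using that by (simp add: mult_ac)
  have "((\<lambda>s. of_nat N powr (1 - s)) has_field_derivative of_real (ln (real N)) * of_nat N powr (1 - (- 1)) * (- 1)) (at (- 1 :: complex))"
    by (rule has_field_derivative_of_nat_powr) (use assms in \<open>auto intro!: derivative_eq_intros\<close>)
  hence 1: "((\<lambda>s. of_nat N powr (1 - s)) has_field_derivative - (of_nat N ^ 2) * of_real (ln (real N))) (at (- 1 :: complex))"
    using N by (simp add: powr_numeral mult_ac)
  have "((\<lambda>s. of_nat N powr (- s - 1)) has_field_derivative of_real (ln (real N)) * of_nat N powr (- (- 1) - 1) * (- 1)) (at (- 1 :: complex))"
    by (rule has_field_derivative_of_nat_powr) (use assms in \<open>auto intro!: derivative_eq_intros\<close>)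
  hence 2: "((\<lambda>s. of_nat N powr (- s - 1)) has_field_derivative - of_real (ln (real N))) (at (- 1 :: complex))"
    using N by simp
  have "(zeta_EM N has_field_derivative
     (\<Sum>n=1..N. - of_nat n * of_real (ln (real n)))
     - ((- (of_nat N ^ 2) * of_real (ln (real N))) * 2 - (of_nat N ^ 2) * (-1)) / 4
     - (- of_nat N * of_real (ln (real N))) / 2 + (1 + (-1) * (- of_real (ln (real N)))) / 12) (at (- 1))"
    unfolding zeta_EM_def
    by (rule derivative_eq_intros refl 1 2 *[OF assms] * | (use N in \<open>simp add: powr_numeral algebra_simps; fail\<close>))+
  hence "deriv (zeta_EM N) (- 1) = (\<Sum>n=1..N. - of_nat n * of_real (ln (real n)))
     - ((- (of_nat N ^ 2) * of_real (ln (real N))) * 2 - (of_nat N ^ 2) * (-1)) / 4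
     - (- of_nat N * of_real (ln (real N))) / 2 + (1 + (-1) * (- of_real (ln (real N)))) / 12"
    by (rule DERIV_imp_deriv)
  also have "\<dots> = of_real (- (\<Sum>n=1..N. real n * ln (real n))
     + (real N ^ 2 / 2 + real N / 2 + 1 / 12) * ln (real N) - real N ^ 2 / 4 + 1 / 12)"
    by (simp add: sum_negf field_simps)
  finally show ?thesis .
qed

lemma ln_glaisher_kinkelin_LIMSEQ:
  "(\<lambda>N. (\<Sum>n=1..Suc N. real n * ln (real n)) -
     (real (Suc N) ^ 2 / 2 + real (Suc N) / 2 + 1 / 12) * ln (real (Suc N)) + real (Suc N) ^ 2 / 4)
   \<longlonglongrightarrow> ln glaisher_kinkelin"
proof -
  have "(\<lambda>N. 1 / 12 - Re (deriv (zeta_EM (Suc N)) (- 1))) \<longlonglongrightarrow> 1 / 12 - Re (deriv riemann_zeta (- 1))"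
    by (intro tendsto_intros deriv_zeta_EM_tendsto) auto
  moreover have "1 / 12 - Re (deriv (zeta_EM (Suc N)) (- 1)) = (\<Sum>n=1..Suc N. real n * ln (real n)) -
     (real (Suc N) ^ 2 / 2 + real (Suc N) / 2 + 1 / 12) * ln (real (Suc N)) + real (Suc N) ^ 2 / 4" for N
  proof -
    have "1 \<le> Suc N" by simp
    thus ?thesis unfolding deriv_zeta_EM_minus_1[OF \<open>1 \<le> Suc N\<close>] Re_complex_of_real by simp
  qed
  ultimately show ?thesis unfolding glaisher_kinkelin_def by simp
qed

section \<open>Fourier expansion of the third Bernoulli polynomial\<close>

lemma Im_Ln_one_minus_cis:
  assumes "0 < x" "x < 2 * pi"
  shows "Im (Ln (1 - cis x)) = (x - pi) / 2"
proof -
  define y where "y = x / 2"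
  have y: "0 < y" "y < pi" "x = 2 * y" using assms by (auto simp: y_def)
  have s: "sin y > 0" using y sin_gt_zero by auto
  have "exp (Complex (ln (2 * sin y)) (y - pi / 2)) = of_real (2 * sin y) * cis (y - pi / 2)"
    using s by (subst exp_eq_polar) simp
  also have "\<dots> = 1 - cis x"
    unfolding y(3) by (rule complex_eqI)
      (simp_all add: cos_diff sin_diff sin_double cos_double_sin power2_eq_square)
  finally have "Ln (1 - cis x) = Complex (ln (2 * sin y)) (y - pi / 2)"
    using y by (intro Ln_unique) auto
  thus ?thesis using y by (simp add: field_simps)
qed

lemma Re_one_minus_scaled_cis_pos:
  assumes "0 \<le> r" "r < 1"
  shows "Re (1 - of_real r * cis x) > 0"
proof -
  have "r * cos x \<le> r * 1" using assms by (intro mult_left_mono) auto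
  thus ?thesis using assms by simp
qed

text \<open>
  The imaginary part of the power series of \<open>Ln (1 - z)\<close> at \<open>z = r * cis x\<close>.
\<close>
lemma sin_power_series:
  assumes "0 \<le> r" "r < 1"
  shows "(\<lambda>n. r ^ Suc n * sin (real (Suc n) * x) / real (Suc n)) sums (- Im (Ln (1 - of_real r * cis x)))"
proof -
  define z where "z = of_real r * cis x"
  have "norm (- z) < 1" using assms by (simp add: z_def norm_mult)
  from sums_minus[OF sums_Im[OF Ln_series[OF this]]]
  have "(\<lambda>n. - Im ((- 1) ^ Suc n / of_nat n * (- z) ^ n)) sums (- Im (Ln (1 - z)))" by simp
  also have "(\<lambda>n. - Im ((- 1) ^ Suc n / of_nat n * (- z) ^ n)) = (\<lambda>n. r ^ n * sin (real n * x) / real n)"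
  proof
    fix n
    have "(- 1) ^ Suc n / of_nat n * (- z) ^ n = - (z ^ n / of_nat n)"
    proof -
      have "(- 1) ^ n * (- z) ^ n = ((- 1) * (- z)) ^ n" by (simp only: power_mult_distrib)
      also have "\<dots> = z ^ n" by simp
      finally have "(- 1) ^ n * (- z) ^ n = z ^ n" .
      thus ?thesis by simp
    qed
    also have "z ^ n = of_real (r ^ n) * cis (real n * x)"
      by (simp add: z_def power_mult_distrib Complex.DeMoivre)
    finally have e: "(- 1) ^ Suc n / of_nat n * (- z) ^ n = - (of_real (r ^ n) * cis (real n * x) / of_nat n)" .
    show "- Im ((- 1) ^ Suc n / of_nat n * (- z) ^ n) = r ^ n * sin (real n * x) / real n"
      unfolding e by (simp add: Im_divide_of_nat)
  qed
  finally show ?thesis unfolding z_def by (subst sums_Suc_iff) simp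
qed

text \<open>
  The double integral of \<open>sin (n * x) / n\<close>, written as one integral with the kernel \<open>t - x\<close>.
\<close>
lemma has_integral_sin_kernel:
  fixes t :: real
  assumes "t \<ge> 0" "n \<ge> 1"
  shows "((\<lambda>x. (t - x) * (sin (real n * x) / real n)) has_integral (t / real n ^ 2 - sin (real n * t) / real n ^ 3)) {0..t}"
proof -
  define F where "F = (\<lambda>x. - ((t - x) * cos (real n * x) / real n ^ 2) - sin (real n * x) / real n ^ 3)"
  have n: "real n \<noteq> 0" using assms by simp
  have "((\<lambda>x. (t - x) * (sin (real n * x) / real n)) has_integral (F t - F 0)) {0..t}"
  proof (rule fundamental_theorem_of_calculus[OF assms(1)])
    fix x
    show "(F has_vector_derivative (t - x) * (sin (real n * x) / real n)) (at x within {0..t})"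
      unfolding F_def has_real_derivative_iff_has_vector_derivative[symmetric]
      by (rule derivative_eq_intros refl | (use n in \<open>simp add: field_simps power2_eq_square power3_eq_cube; fail\<close>))+
  qed
  thus ?thesis by (simp add: F_def)
qed

text \<open>
  Integration term by term of a series that satisfies the Weierstrass test.
\<close>
lemma has_integral_suminf_Weierstrass:
  fixes f :: "nat \<Rightarrow> real \<Rightarrow> real"
  assumes int: "\<And>n. (f n has_integral I n) {a..b}" and cont: "\<And>n. continuous_on {a..b} (f n)"
    and bound: "\<And>n x. x \<in> {a..b} \<Longrightarrow> \<bar>f n x\<bar> \<le> M n" and M: "summable M"
  shows "((\<lambda>x. \<Sum>n. f n x) has_integral (\<Sum>n. I n)) {a..b}" "summable I"
proof -
  have lim: "uniform_limit {a..b} (\<lambda>n x. \<Sum>i<n. f i x) (\<lambda>x. \<Sum>i. f i x) sequentially"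
    using bound M by (intro Weierstrass_m_test) auto
  have cont': "continuous_on {a..b} (\<lambda>x. \<Sum>i<n. f i x)" for n
    by (intro continuous_on_sum cont)
  obtain K J where K: "\<And>n. ((\<lambda>x. \<Sum>i<n. f i x) has_integral K n) {a..b}"
    and J: "((\<lambda>x. \<Sum>i. f i x) has_integral J) {a..b}" and KJ: "K \<longlonglongrightarrow> J"
    using uniform_limit_integral[OF lim cont'] by (metis sequentially_bot)
  have "K = (\<lambda>n. \<Sum>i<n. I i)"
    by (rule ext, rule has_integral_unique[OF K has_integral_sum[OF _ int]]) auto
  with KJ have "I sums J" by (simp only: sums_def)
  thus "((\<lambda>x. \<Sum>n. f n x) has_integral (\<Sum>n. I n)) {a..b}" "summable I"
    using J by (auto simp: sums_iff)
qed

lemma sum_sin_cubes_Abel: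
  assumes r: "0 \<le> r" "r < 1" and t: "t \<ge> 0"
  shows "((\<lambda>x. (t - x) * (- Im (Ln (1 - of_real r * cis x)))) has_integral
    (\<Sum>n. r ^ Suc n * (t / real (Suc n) ^ 2 - sin (real (Suc n) * t) / real (Suc n) ^ 3))) {0..t}"
proof -
  define f where "f = (\<lambda>n x. r ^ Suc n * ((t - x) * (sin (real (Suc n) * x) / real (Suc n))))"
  have "((\<lambda>x. \<Sum>n. f n x) has_integral
    (\<Sum>n. r ^ Suc n * (t / real (Suc n) ^ 2 - sin (real (Suc n) * t) / real (Suc n) ^ 3))) {0..t}"
  proof (rule has_integral_suminf_Weierstrass(1))
    show "(f n has_integral r ^ Suc n * (t / real (Suc n) ^ 2 - sin (real (Suc n) * t) / real (Suc n) ^ 3)) {0..t}" for n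
      unfolding f_def by (intro has_integral_mult_right has_integral_sin_kernel t) auto
    show "continuous_on {0..t} (f n)" for n
      unfolding f_def by (intro continuous_intros) auto
  next
    fix n x assume x: "x \<in> {0..t}"
    have "\<bar>sin (real (Suc n) * x) / real (Suc n)\<bar> \<le> 1 / 1"
      unfolding abs_divide by (intro frac_le) auto
    hence "\<bar>f n x\<bar> \<le> r ^ Suc n * (t * 1)"
      unfolding f_def abs_mult using x r by (intro mult_mono) auto
    thus "\<bar>f n x\<bar> \<le> r ^ Suc n * t" by simp
  next
    show "summable (\<lambda>n. r ^ Suc n * t)"
      using r by (intro summable_mult2) (subst summable_Suc_iff, rule summable_geometric, simp)
  qed
  moreover have "(\<Sum>i. f i x) = (t - x) * (- Im (Ln (1 - of_real r * cis x)))" for x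
    using sums_mult[OF sin_power_series[OF r, of x], of "t - x"]
    by (intro sums_unique[symmetric]) (simp add: f_def mult_ac)
  ultimately show ?thesis by simp
qed

lemma summable_inverse_Suc_power:
  "k \<ge> 2 \<Longrightarrow> summable (\<lambda>n. 1 / real (Suc n) ^ k)"
  using inverse_power_summable[of k, where 'a = real] by (subst summable_Suc_iff) (simp add: inverse_eq_divide)

text \<open>
  The limit \<open>r \<rightarrow> 1\<close> in \<open>sum_sin_cubes_Abel\<close>: the series converges by dominated summation, and the
  integral by dominated convergence, since \<open>1 - r * cis x\<close> lies in the right half-plane, where the
  imaginary part of \<open>Ln\<close> is at most \<open>pi / 2\<close> in absolute value and tends to \<open>(x - pi) / 2\<close>.
\<close>
lemma sin_cubes_sums:
  assumes t: "0 \<le> t" "t \<le> 2 * pi"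
  shows "(\<lambda>n. sin (real (Suc n) * t) / real (Suc n) ^ 3) sums (pi\<^sup>2 * t / 6 - pi * t\<^sup>2 / 4 + t ^ 3 / 12)"
proof -
  define c where "c = (\<lambda>n. t / real (Suc n) ^ 2 - sin (real (Suc n) * t) / real (Suc n) ^ 3)"
  define r where "r = (\<lambda>k. 1 - 1 / real (k + 2))"
  have r: "0 \<le> r k" "r k < 1" for k by (auto simp: r_def field_simps)
  have r_lim: "r \<longlonglongrightarrow> 1" unfolding r_def by real_asymp
  have sin_summable: "summable (\<lambda>n. sin (real (Suc n) * t) / real (Suc n) ^ 3)"
  proof (rule summable_comparison_test'[OF summable_inverse_Suc_power[of 3]])
    show "norm (sin (real (Suc n) * t) / real (Suc n) ^ 3) \<le> 1 / real (Suc n) ^ 3" for n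
      unfolding norm_divide by (intro frac_le) auto
  qed auto
  have c_summable: "summable (\<lambda>n. t * (1 / real (Suc n) ^ 2) + 1 / real (Suc n) ^ 3)"
    by (intro summable_add summable_mult summable_inverse_Suc_power) auto
  have c_bound: "norm (r k ^ Suc n * c n) \<le> t * (1 / real (Suc n) ^ 2) + 1 / real (Suc n) ^ 3" for k n
  proof -
    have "norm (r k ^ Suc n * c n) \<le> 1 * norm (c n)"
      unfolding norm_mult norm_power using r[of k] by (intro mult_right_mono power_le_one) auto
    also have "norm (c n) \<le> norm (t / real (Suc n) ^ 2) + norm (sin (real (Suc n) * t) / real (Suc n) ^ 3)"
      unfolding c_def by (rule norm_triangle_ineq4)
    also have "\<dots> \<le> t * (1 / real (Suc n) ^ 2) + 1 / real (Suc n) ^ 3"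
      unfolding norm_divide using t by (intro add_mono frac_le) auto
    finally show ?thesis by simp
  qed
  have lim1: "(\<lambda>k. \<Sum>n. r k ^ Suc n * c n) \<longlonglongrightarrow> (\<Sum>n. 1 ^ Suc n * c n)"
  proof (rule tannerys_theorem[where M = "\<lambda>n. t * (1 / real (Suc n) ^ 2) + 1 / real (Suc n) ^ 3", THEN conjunct2, THEN conjunct2])
    show "(\<lambda>k. r k ^ Suc n * c n) \<longlonglongrightarrow> 1 ^ Suc n * c n" for n
      by (intro tendsto_intros r_lim)
    show "\<forall>\<^sub>F (n, k) in sequentially \<times>\<^sub>F sequentially.
        norm (r k ^ Suc n * c n) \<le> t * (1 / real (Suc n) ^ 2) + 1 / real (Suc n) ^ 3"
      using c_bound by (intro always_eventually) blast
  qed (use c_summable in auto)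
  define f where "f = (\<lambda>k x. (t - x) * (- Im (Ln (1 - of_real (r k) * cis x))))"
  define g where "g = (\<lambda>x. (t - x) * ((pi - x) / 2))"
  \<comment> \<open>at \<open>x = 0\<close> the pointwise limit is 0 and not \<open>g 0\<close>; at \<open>x = 2 * pi = t\<close> the kernel vanishes\<close>
  define g' where "g' = (\<lambda>x. if x = 0 then 0 else g x)"
  have f: "(f k has_integral (\<Sum>n. r k ^ Suc n * c n)) {0..t}" for k
    unfolding f_def c_def by (rule sum_sin_cubes_Abel[OF r t(1)])
  have "(\<lambda>k. f k x) \<longlonglongrightarrow> g' x" if x: "x \<in> {0..t}" for x
  proof (cases "x = 0 \<or> x = 2 * pi")
    case True
    have "f k x = 0" for k
    proof -
      have "cis x = 1" using True by auto
      moreover have "Im (Ln (of_real (1 - r k))) = 0" using r[of k] by (intro Im_Ln_of_real) simp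
      ultimately show ?thesis by (simp add: f_def)
    qed
    moreover have "g' x = 0" using True t x by (auto simp: g'_def g_def)
    ultimately show ?thesis by simp
  next
    case False
    hence x': "0 < x" "x < 2 * pi" using x t by auto
    have "cos x < 1" using x' by (smt (verit) cos_2pi_minus cos_monotone_0_pi cos_zero pi_gt_zero)
    hence nz: "1 - of_real 1 * cis x \<notin> \<real>\<^sub>\<le>\<^sub>0" by (auto simp: complex_nonpos_Reals_iff)
    have "(\<lambda>k. f k x) \<longlonglongrightarrow> (t - x) * (- Im (Ln (1 - of_real 1 * cis x)))"
      unfolding f_def by (intro tendsto_intros r_lim nz)
    moreover have "- Im (Ln (1 - of_real 1 * cis x)) = (pi - x) / 2"
      using Im_Ln_one_minus_cis[OF x'] by simp
    ultimately show ?thesis using x' by (simp only: g'_def g_def) simp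
  qed
  note lim = this
  have bound: "norm (f k x) \<le> t * (pi / 2)" if x: "x \<in> {0..t}" for k x
    unfolding f_def norm_mult
    using Re_Ln_pos_lt_imp[OF Re_one_minus_scaled_cis_pos[OF r[of k], of x]] x t by (intro mult_mono) auto
  have "f k integrable_on {0..t}" for k using f by blast
  hence dc: "g' integrable_on {0..t}" "(\<lambda>k. integral {0..t} (f k)) \<longlonglongrightarrow> integral {0..t} g'"
    by (auto intro: dominated_convergence[OF _ integrable_const_ivl bound lim])
  have "(g has_integral (pi * t\<^sup>2 / 4 - t ^ 3 / 12)) {0..t}"
  proof -
    define G where "G = (\<lambda>x. (t * pi * x - (t + pi) * x\<^sup>2 / 2 + x ^ 3 / 3) / 2)"
    have "(g has_integral (G t - G 0)) {0..t}"
    proof (rule fundamental_theorem_of_calculus[OF t(1)])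
      fix x
      show "(G has_vector_derivative g x) (at x within {0..t})"
        unfolding G_def g_def has_real_derivative_iff_has_vector_derivative[symmetric]
        by (rule derivative_eq_intros refl | (simp add: field_simps power2_eq_square; fail))+
    qed
    thus ?thesis by (simp add: G_def field_simps power2_eq_square power3_eq_cube)
  qed
  hence "(g' has_integral (pi * t\<^sup>2 / 4 - t ^ 3 / 12)) {0..t}"
    by (rule has_integral_spike_finite[of "{0}", rotated -1]) (auto simp: g'_def)
  hence "integral {0..t} g' = pi * t\<^sup>2 / 4 - t ^ 3 / 12" by (rule integral_unique)
  moreover have "integral {0..t} (f k) = (\<Sum>n. r k ^ Suc n * c n)" for k using f integral_unique by blast
  ultimately have sumc: "(\<Sum>n. c n) = pi * t\<^sup>2 / 4 - t ^ 3 / 12"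
    using LIMSEQ_unique[OF lim1] dc(2) by simp
  have "c sums (t * (pi\<^sup>2 / 6) - (\<Sum>n. sin (real (Suc n) * t) / real (Suc n) ^ 3))"
  proof -
    have "(\<lambda>n. t * (1 / real (Suc n) ^ 2)) sums (t * (pi\<^sup>2 / 6))"
      using sums_mult[OF inverse_squares_sums] by (simp add: add.commute)
    from sums_diff[OF this summable_sums[OF sin_summable]] show ?thesis by (simp add: c_def)
  qed
  from sums_unique[OF this] sumc
  have "(\<Sum>n. sin (real (Suc n) * t) / real (Suc n) ^ 3) = pi\<^sup>2 * t / 6 - pi * t\<^sup>2 / 4 + t ^ 3 / 12"
    by (simp add: algebra_simps)
  thus ?thesis using summable_sums[OF sin_summable] by simp
qed

section \<open>Reduction to the sine integral\<close>

lemma Bernoulli3_sums: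
  assumes "0 \<le> u" "u \<le> 1"
  shows "(\<lambda>n. 3 / (2 * pi ^ 3) / real (Suc n) ^ 3 * sin (2 * pi * real (Suc n) * u)) sums (u * (u - 1 / 2) * (u - 1))"
proof -
  have "(\<lambda>n. 3 / (2 * pi ^ 3) * (sin (real (Suc n) * (2 * pi * u)) / real (Suc n) ^ 3)) sums
     (3 / (2 * pi ^ 3) * (pi\<^sup>2 * (2 * pi * u) / 6 - pi * (2 * pi * u)\<^sup>2 / 4 + (2 * pi * u) ^ 3 / 12))"
    using assms by (intro sums_mult sin_cubes_sums) auto
  also have "3 / (2 * pi ^ 3) * (pi\<^sup>2 * (2 * pi * u) / 6 - pi * (2 * pi * u)\<^sup>2 / 4 + (2 * pi * u) ^ 3 / 12)
     = u * (u - 1 / 2) * (u - 1)"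
    by (simp add: field_simps power2_eq_square power3_eq_cube)
  finally show ?thesis by (simp add: mult_ac)
qed

lemma abs_sinc_le: "\<bar>sinc x\<bar> \<le> 1"
  using abs_sin_x_le_abs_x[of x] by (auto simp: field_simps)

text \<open>
  The value of the integral of \<open>B (t - k) / t\<close> over \<open>[k, k + 1]\<close>, where \<open>B u = u (u - 1/2) (u - 1)\<close>.
  For \<open>k = 0\<close> the logarithms are multiplied by 0, so the default value of \<open>ln 0\<close> plays no role.
\<close>
definition Bernoulli3_integral :: "nat \<Rightarrow> real" where
  "Bernoulli3_integral k = real k ^ 2 + real k + 1 / 12
     - real k * (real k + 1 / 2) * (real k + 1) * (ln (real k + 1) - ln (real k))"

lemma has_integral_Bernoulli3_over_t:
  defines "B \<equiv> \<lambda>u::real. u * (u - 1 / 2) * (u - 1)"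
  shows "((\<lambda>t. B (t - real k) / t) has_integral Bernoulli3_integral k) {real k..real k + 1}"
proof -
  define c where "c = real k * (real k + 1 / 2) * (real k + 1)"
  define F where "F = (\<lambda>t. t ^ 3 / 3 - 3 * (real k + 1 / 2) * t ^ 2 / 2 + (3 * real k ^ 2 + 3 * real k + 1 / 2) * t - c * ln t)"
  define g where "g = (\<lambda>t. t ^ 2 - 3 * (real k + 1 / 2) * t + (3 * real k ^ 2 + 3 * real k + 1 / 2) - c / t)"
  have "(g has_integral (F (real k + 1) - F (real k))) {real k..real k + 1}"
  proof (rule fundamental_theorem_of_calculus)
    fix t assume t: "t \<in> {real k..real k + 1}"
    have "((\<lambda>t. c * ln t) has_real_derivative c / t) (at t within {real k..real k + 1})"
    proof (cases "k = 0")
      case False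
      hence "t > 0" using t by auto
      thus ?thesis by (auto intro!: derivative_eq_intros)
    qed (simp add: c_def)
    note ln_deriv = this
    show "(F has_vector_derivative g t) (at t within {real k..real k + 1})"
      unfolding F_def g_def has_real_derivative_iff_has_vector_derivative[symmetric]
      by (rule ln_deriv derivative_eq_intros refl | (simp; fail))+
  qed auto
  moreover have "F (real k + 1) - F (real k) = Bernoulli3_integral k"
    unfolding F_def Bernoulli3_integral_def c_def[symmetric]
    by (simp add: field_simps power2_eq_square power3_eq_cube)
  ultimately have "(g has_integral Bernoulli3_integral k) {real k..real k + 1}" by simp
  thus ?thesis
  \<comment> \<open>for \<open>k = 0\<close> the integrand is 0 at the left end point because of the division by 0\<close>
  proof (rule has_integral_spike_finite[of "{0}", rotated -1])
    fix t assume "t \<in> {real k..real k + 1} - {0}"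
    thus "B (t - real k) / t = g t"
      by (simp add: B_def g_def c_def field_simps power2_eq_square power3_eq_cube)
  qed auto
qed

lemma Bernoulli3_integral_sums_Si:
  "(\<lambda>n. 3 / (2 * pi ^ 3) / real (Suc n) ^ 3 *
      (Si (2 * pi * real (Suc n) * (real k + 1)) - Si (2 * pi * real (Suc n) * real k))) sums Bernoulli3_integral k"
proof -
  define w where "w = (\<lambda>n. 2 * pi * real (Suc n))"
  define f where "f = (\<lambda>n t. 3 / (2 * pi ^ 3) / real (Suc n) ^ 3 * (w n * sinc (w n * t)))"
  define I where "I = (\<lambda>n. 3 / (2 * pi ^ 3) / real (Suc n) ^ 3 * (Si (w n * (real k + 1)) - Si (w n * real k)))"
  have w: "w n > 0" for n by (simp add: w_def)
  have int: "(f n has_integral I n) {real k..real k + 1}" for n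
    unfolding f_def I_def
  proof (intro has_integral_mult_right fundamental_theorem_of_calculus)
    fix t
    have "((\<lambda>t. Si (w n * t)) has_real_derivative sinc (w n * t) * w n) (at t within {real k..real k + 1})"
      by (rule DERIV_chain2[OF DERIV_Si]) (auto intro!: derivative_eq_intros)
    thus "((\<lambda>t. Si (w n * t)) has_vector_derivative w n * sinc (w n * t)) (at t within {real k..real k + 1})"
      unfolding has_real_derivative_iff_has_vector_derivative by (simp only: mult.commute)
  qed auto
  have cont: "continuous_on {real k..real k + 1} (f n)" for n
    unfolding f_def by (intro continuous_on_mult continuous_on_const continuous_on_sinc continuous_on_id)
  have bound: "\<bar>f n t\<bar> \<le> 3 / pi ^ 2 * (1 / real (Suc n) ^ 2)" for n t
  proof -
    have "\<bar>f n t\<bar> = 3 / (2 * pi ^ 3) / real (Suc n) ^ 3 * w n * \<bar>sinc (w n * t)\<bar>"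
      unfolding f_def using w[of n] by (simp add: abs_mult)
    also have "\<dots> \<le> 3 / (2 * pi ^ 3) / real (Suc n) ^ 3 * w n * 1"
      using w[of n] by (intro mult_left_mono abs_sinc_le) auto
    also have "\<dots> = 3 / pi ^ 2 * (1 / real (Suc n) ^ 2)"
      unfolding w_def by (simp add: power2_eq_square power3_eq_cube del: of_nat_Suc)
    finally show ?thesis .
  qed
  note int_sum = has_integral_suminf_Weierstrass[OF int cont bound summable_mult[OF summable_inverse_Suc_power]]
  have val: "(\<Sum>n. f n t) = (t - real k) * (t - real k - 1 / 2) * (t - real k - 1) / t"
    if t: "t \<in> {real k..real k + 1} - {0}" for t
  proof -
    have "(\<lambda>n. 3 / (2 * pi ^ 3) / real (Suc n) ^ 3 * sin (2 * pi * real (Suc n) * (t - real k)) / t) sums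
             ((t - real k) * (t - real k - 1 / 2) * (t - real k - 1) / t)"
      using t by (intro sums_divide Bernoulli3_sums) auto
    also have "(\<lambda>n. 3 / (2 * pi ^ 3) / real (Suc n) ^ 3 * sin (2 * pi * real (Suc n) * (t - real k)) / t) = (\<lambda>n. f n t)"
    proof
      fix n
      \<comment> \<open>the shift by \<open>k\<close> is a multiple of the period\<close>
      have "2 * pi * real (Suc n) * (t - real k) = w n * t - 2 * real (Suc n * k) * pi"
        by (simp add: w_def algebra_simps)
      hence "sin (2 * pi * real (Suc n) * (t - real k)) = sin (w n * t)"
        by (simp only: sin_diff sin_2npi cos_2npi mult_1_right mult_zero_right diff_0_right)
      thus "3 / (2 * pi ^ 3) / real (Suc n) ^ 3 * sin (2 * pi * real (Suc n) * (t - real k)) / t = f n t"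
        using w[of n] t by (simp add: f_def del: of_nat_Suc)
    qed
    finally show ?thesis by (rule sums_unique[symmetric])
  qed
  have "((\<lambda>t. (t - real k) * (t - real k - 1 / 2) * (t - real k - 1) / t) has_integral (\<Sum>n. I n)) {real k..real k + 1}"
    by (rule has_integral_spike_finite[OF _ _ int_sum(1), of "{0}"]) (use val in auto)
  hence "(\<Sum>n. I n) = Bernoulli3_integral k"
    using has_integral_Bernoulli3_over_t[of k] has_integral_unique by blast
  moreover have "summable I" using int_sum(2) by simp
  ultimately show ?thesis unfolding I_def w_def by (simp add: sums_iff)
qed

lemma sum_Bernoulli3_integral_LIMSEQ:
  "(\<lambda>N. \<Sum>k<N. Bernoulli3_integral k) \<longlonglongrightarrow> 3 / (4 * pi\<^sup>2) * (\<Sum>n. 1 / real (Suc n) ^ 3)"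
proof -
  define C where "C = (\<lambda>n. 3 / (2 * pi ^ 3) / real (Suc n) ^ 3)"
  have Si0: "Si 0 = 0" using Si_neg[of 0] by simp
  have sums: "(\<lambda>n. C n * Si (2 * pi * real (Suc n) * real N)) sums (\<Sum>k<N. Bernoulli3_integral k)" for N
  proof -
    have "(\<lambda>n. \<Sum>k<N. C n * (Si (2 * pi * real (Suc n) * (real k + 1)) - Si (2 * pi * real (Suc n) * real k)))
            sums (\<Sum>k<N. Bernoulli3_integral k)"
      unfolding C_def by (intro sums_sum Bernoulli3_integral_sums_Si)
    also have "(\<lambda>n. \<Sum>k<N. C n * (Si (2 * pi * real (Suc n) * (real k + 1)) - Si (2 * pi * real (Suc n) * real k)))
        = (\<lambda>n. C n * Si (2 * pi * real (Suc n) * real N))"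
    proof
      fix n
      have "(\<Sum>k<N. Si (2 * pi * real (Suc n) * real (Suc k)) - Si (2 * pi * real (Suc n) * real k)) =
              Si (2 * pi * real (Suc n) * real N) - Si (2 * pi * real (Suc n) * real 0)"
        by (rule sum_lessThan_telescope)
      thus "(\<Sum>k<N. C n * (Si (2 * pi * real (Suc n) * (real k + 1)) - Si (2 * pi * real (Suc n) * real k))) =
              C n * Si (2 * pi * real (Suc n) * real N)"
        by (simp add: sum_distrib_left[symmetric] Si0 add.commute)
    qed
    finally show ?thesis .
  qed
  obtain B where B: "\<And>T. \<bar>Si T\<bar> \<le> B" using bounded_Si by blast
  have C: "C n \<ge> 0" for n by (simp add: C_def)
  have "(\<lambda>N. \<Sum>n. C n * Si (2 * pi * real (Suc n) * real N)) \<longlonglongrightarrow> (\<Sum>n. C n * (pi / 2))"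
  proof (rule tannerys_theorem[where M = "\<lambda>n. 3 / (2 * pi ^ 3) * (1 / real (Suc n) ^ 3) * B", THEN conjunct2, THEN conjunct2])
    fix n
    have "filterlim (\<lambda>N. 2 * pi * real (Suc n) * real N) at_top sequentially"
      by (rule filterlim_tendsto_pos_mult_at_top[OF tendsto_const _ filterlim_real_sequentially]) simp
    thus "(\<lambda>N. C n * Si (2 * pi * real (Suc n) * real N)) \<longlonglongrightarrow> C n * (pi / 2)"
      by (intro tendsto_intros filterlim_compose[OF Si_at_top])
  next
    have "norm (C n * Si (2 * pi * real (Suc n) * real N)) \<le> 3 / (2 * pi ^ 3) * (1 / real (Suc n) ^ 3) * B" for n N
      using B C[of n] mult_left_mono[OF B C[of n], of "2 * pi * real (Suc n) * real N"]
      by (simp add: abs_mult C_def)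
    thus "\<forall>\<^sub>F (n, N) in sequentially \<times>\<^sub>F sequentially.
        norm (C n * Si (2 * pi * real (Suc n) * real N)) \<le> 3 / (2 * pi ^ 3) * (1 / real (Suc n) ^ 3) * B"
      by (intro always_eventually) blast
  next
    show "summable (\<lambda>n. 3 / (2 * pi ^ 3) * (1 / real (Suc n) ^ 3) * B)"
      by (intro summable_mult summable_mult2 summable_inverse_Suc_power) simp
  qed auto
  moreover have "(\<Sum>n. C n * Si (2 * pi * real (Suc n) * real N)) = (\<Sum>k<N. Bernoulli3_integral k)" for N
    using sums[of N] by (rule sums_unique[symmetric])
  moreover have "(\<Sum>n. C n * (pi / 2)) = 3 / (4 * pi\<^sup>2) * (\<Sum>n. 1 / real (Suc n) ^ 3)"
    by (subst suminf_mult[symmetric, OF summable_inverse_Suc_power])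
       (auto intro!: suminf_cong simp: C_def power2_eq_square power3_eq_cube)
  ultimately show ?thesis by simp
qed

section \<open>Integration of the Weierstrass product\<close>

text \<open>
  The logarithm of the factor with index \<open>k\<close>, for \<open>k \<ge> 1\<close> and \<open>x \<ge> 0\<close>.
\<close>
definition ln_Gamma3_factor :: "nat \<Rightarrow> real \<Rightarrow> real" where
  "ln_Gamma3_factor k x = - (real k * (real k + 1) / 2) * ln (1 + x / real k) +
     (1 + 1 / real k) * (1 / 2 * real k * x - 1 / 4 * x ^ 2 + 1 / (6 * real k) * x ^ 3)"

lemma Gamma3_factor_eq_exp:
  fixes x :: real
  assumes "k \<ge> 1" "x \<ge> 0"
  shows "Gamma3_factor x k = exp (ln_Gamma3_factor k x)"
proof -
  have pos: "1 + x / real k > 0" using assms by (intro add_pos_nonneg) auto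
  have m: "real (k * (k + 1) div 2) = real k * (real k + 1) / 2"
    by (subst real_of_nat_div) (auto simp: algebra_simps)
  have "(1 + x / real k) powi (- int (k * (k + 1) div 2)) =
          exp (- (real k * (real k + 1) / 2) * ln (1 + x / real k))"
    using pos unfolding m[symmetric] by (simp add: power_int_minus exp_minus exp_of_nat_mult)
  thus ?thesis by (simp only: Gamma3_factor_def ln_Gamma3_factor_def exp_add)
qed

lemma ln_one_plus_cubic_bounds:
  fixes y :: real
  assumes "y \<ge> 0"
  shows "y - y ^ 2 / 2 + y ^ 3 / 3 - y ^ 4 / 4 \<le> ln (1 + y)" "ln (1 + y) \<le> y - y ^ 2 / 2 + y ^ 3 / 3"
proof -
  have "0 - 0 ^ 2 / 2 + 0 ^ 3 / 3 - ln (1 + 0) \<le> y - y ^ 2 / 2 + y ^ 3 / 3 - ln (1 + y)"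
  proof (rule DERIV_nonneg_imp_nondecreasing[OF assms])
    fix x assume x: "0 \<le> x" "x \<le> y"
    have "((\<lambda>y. y - y ^ 2 / 2 + y ^ 3 / 3 - ln (1 + y)) has_real_derivative x ^ 3 / (1 + x)) (at x)"
      by (rule derivative_eq_intros refl | (use x in \<open>simp add: field_simps power2_eq_square power3_eq_cube; fail\<close>))+
    thus "\<exists>z. ((\<lambda>y. y - y ^ 2 / 2 + y ^ 3 / 3 - ln (1 + y)) has_real_derivative z) (at x) \<and> 0 \<le> z"
      using x by (intro exI[of _ "x ^ 3 / (1 + x)"]) auto
  qed
  thus "ln (1 + y) \<le> y - y ^ 2 / 2 + y ^ 3 / 3" by simp
  have "ln (1 + 0) - (0 - 0 ^ 2 / 2 + 0 ^ 3 / 3 - 0 ^ 4 / 4) \<le> ln (1 + y) - (y - y ^ 2 / 2 + y ^ 3 / 3 - y ^ 4 / 4)"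
  proof (rule DERIV_nonneg_imp_nondecreasing[OF assms])
    fix x assume x: "0 \<le> x" "x \<le> y"
    have "((\<lambda>y. ln (1 + y) - (y - y ^ 2 / 2 + y ^ 3 / 3 - y ^ 4 / 4)) has_real_derivative x ^ 4 / (1 + x)) (at x)"
      by (rule derivative_eq_intros refl | (use x in \<open>simp add: field_simps power2_eq_square power3_eq_cube power4_eq_xxxx; fail\<close>))+
    thus "\<exists>z. ((\<lambda>y. ln (1 + y) - (y - y ^ 2 / 2 + y ^ 3 / 3 - y ^ 4 / 4)) has_real_derivative z) (at x) \<and> 0 \<le> z"
      using x by (intro exI[of _ "x ^ 4 / (1 + x)"]) auto
  qed
  thus "y - y ^ 2 / 2 + y ^ 3 / 3 - y ^ 4 / 4 \<le> ln (1 + y)" by simp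
qed

lemma abs_ln_Gamma3_factor_le:
  assumes "k \<ge> 1" "0 \<le> x" "x \<le> 1"
  shows "\<bar>ln_Gamma3_factor k x\<bar> \<le> 1 / real k ^ 2"
proof -
  define m where "m = real k * (real k + 1) / 2"
  define y where "y = x / real k"
  define h where "h = y - y ^ 2 / 2 + y ^ 3 / 3 - ln (1 + y)"
  have k: "real k \<ge> 1" using assms by simp
  have y: "0 \<le> y" using assms by (simp add: y_def)
  have m: "0 \<le> m" "m \<le> real k ^ 2" using k by (auto simp: m_def power2_eq_square field_simps)
  have "ln_Gamma3_factor k x = m * h"
    using k unfolding ln_Gamma3_factor_def h_def m_def y_def
    by (simp add: field_simps power2_eq_square power3_eq_cube)
  moreover have "0 \<le> h" "h \<le> y ^ 4 / 4" using ln_one_plus_cubic_bounds[OF y] by (simp_all add: h_def)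
  moreover have "y ^ 4 / 4 \<le> 1 / real k ^ 4"
  proof -
    have "y ^ 4 \<le> (1 / real k) ^ 4" using assms k by (intro power_mono) (auto simp: y_def field_simps)
    moreover have "y ^ 4 / 4 \<le> y ^ 4" by simp
    ultimately show ?thesis unfolding power_one_over by linarith
  qed
  ultimately have "0 \<le> ln_Gamma3_factor k x" "ln_Gamma3_factor k x \<le> real k ^ 2 * (1 / real k ^ 4)"
    using m mult_mono[OF m(2), of h "1 / real k ^ 4"] by simp_all
  moreover have "real k ^ 2 * (1 / real k ^ 4) = 1 / real k ^ 2"
    using k by (simp add: field_simps power2_eq_square power4_eq_xxxx)
  ultimately show ?thesis by simp
qed

text \<open>
  The integral of \<open>ln_Gamma3_factor k\<close> over \<open>[0, 1]\<close>, for \<open>k \<ge> 1\<close>.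
\<close>
definition integral_ln_Gamma3_factor :: "nat \<Rightarrow> real" where
  "integral_ln_Gamma3_factor k = - (real k * (real k + 1) / 2) * ((real k + 1) * (ln (real k + 1) - ln (real k)) - 1)
     + (1 + 1 / real k) * (real k / 4 - 1 / 12 + 1 / (24 * real k))"

lemma has_integral_ln_Gamma3_factor:
  assumes "k \<ge> 1"
  shows "(ln_Gamma3_factor k has_integral integral_ln_Gamma3_factor k) {0..1}"
proof -
  define F where "F = (\<lambda>x. - (real k * (real k + 1) / 2) * ((x + real k) * ln (1 + x / real k) - x) +
     (1 + 1 / real k) * (real k / 4 * x ^ 2 - 1 / 12 * x ^ 3 + 1 / (24 * real k) * x ^ 4))"
  have k: "real k > 0" using assms by simp
  have "(ln_Gamma3_factor k has_integral (F 1 - F 0)) {0..1}"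
  proof (rule fundamental_theorem_of_calculus)
    fix x :: real assume x: "x \<in> {0..1}"
    have pos: "1 + x / real k > 0" using x k by (intro add_pos_nonneg) auto
    have "((\<lambda>x. (x + real k) * ln (1 + x / real k) - x) has_real_derivative ln (1 + x / real k)) (at x within {0..1})"
      by (rule derivative_eq_intros refl pos | (use k pos in \<open>simp add: field_simps; fail\<close>))+
    note 1 = DERIV_cmult[OF this, of "- (real k * (real k + 1) / 2)"]
    have "((\<lambda>x. real k / 4 * x ^ 2 - 1 / 12 * x ^ 3 + 1 / (24 * real k) * x ^ 4) has_real_derivative
        (1 / 2 * real k * x - 1 / 4 * x ^ 2 + 1 / (6 * real k) * x ^ 3)) (at x within {0..1})"
      by (rule derivative_eq_intros refl | (simp; fail))+
    note 2 = DERIV_cmult[OF this, of "1 + 1 / real k"]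
    show "(F has_vector_derivative ln_Gamma3_factor k x) (at x within {0..1})"
      unfolding F_def ln_Gamma3_factor_def has_real_derivative_iff_has_vector_derivative[symmetric]
      by (rule DERIV_add[OF 1 2])
  qed auto
  moreover have "F 1 - F 0 = integral_ln_Gamma3_factor k"
  proof -
    have "ln (1 + 1 / real k) = ln (real k + 1) - ln (real k)"
    proof -
      have "1 + 1 / real k = (real k + 1) / real k" using k by (simp add: field_simps)
      thus ?thesis using k by (simp add: ln_div)
    qed
    thus ?thesis unfolding F_def integral_ln_Gamma3_factor_def by (simp add: add.commute)
  qed
  ultimately show ?thesis by simp
qed

lemma ln_barnes_Gamma3:
  fixes x :: real
  assumes "0 \<le> x" "x \<le> 1"
  shows "ln (barnes_Gamma3 (x + 1)) = Gamma3_c1 * x + Gamma3_c2 * x ^ 2 + Gamma3_c3 * x ^ 3 +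
           (\<Sum>n. ln_Gamma3_factor (Suc n) x)"
proof -
  have "summable (\<lambda>n. ln_Gamma3_factor (Suc n) x)"
  proof (rule summable_comparison_test'[OF summable_inverse_Suc_power[of 2]])
    show "norm (ln_Gamma3_factor (Suc n) x) \<le> 1 / real (Suc n) ^ 2" for n
      using abs_ln_Gamma3_factor_le[of "Suc n" x] assms by simp
  qed auto
  hence "(\<Prod>n. Gamma3_factor x (Suc n)) = exp (\<Sum>n. ln_Gamma3_factor (Suc n) x)"
    using assms by (simp add: Gamma3_factor_eq_exp prodinf_exp)
  thus ?thesis by (simp add: barnes_Gamma3_def exp_add[symmetric])
qed

lemma has_integral_ln_barnes_Gamma3:
  "((\<lambda>x :: real. ln (barnes_Gamma3 (x + 1))) has_integral
     (Gamma3_c1 / 2 + Gamma3_c2 / 3 + Gamma3_c3 / 4 + (\<Sum>n. integral_ln_Gamma3_factor (Suc n)))) {0..1}"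
  and summable_integral_ln_Gamma3_factor: "summable (\<lambda>n. integral_ln_Gamma3_factor (Suc n))"
proof -
  have int: "(ln_Gamma3_factor (Suc n) has_integral integral_ln_Gamma3_factor (Suc n)) {0..1}" for n
    by (rule has_integral_ln_Gamma3_factor) simp
  have cont: "continuous_on {0..1} (ln_Gamma3_factor (Suc n))" for n
  proof -
    have "1 + x / real (Suc n) > 0" if "x \<ge> 0" for x using that by (intro add_pos_nonneg) auto
    hence "\<forall>x\<in>{0..1}. 1 + x / real (Suc n) \<noteq> 0" by force
    thus ?thesis unfolding ln_Gamma3_factor_def by (intro continuous_intros) auto
  qed
  have bound: "\<bar>ln_Gamma3_factor (Suc n) x\<bar> \<le> 1 / real (Suc n) ^ 2" if "x \<in> {0..1}" for n x
    using that by (intro abs_ln_Gamma3_factor_le) auto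
  have two: "(2::nat) \<le> 2" by simp
  note * = has_integral_suminf_Weierstrass[OF int cont bound summable_inverse_Suc_power[OF two]]
  show "summable (\<lambda>n. integral_ln_Gamma3_factor (Suc n))" by (rule *(2))
  have poly: "((\<lambda>x. Gamma3_c1 * x + Gamma3_c2 * x ^ 2 + Gamma3_c3 * x ^ 3) has_integral
     (Gamma3_c1 / 2 + Gamma3_c2 / 3 + Gamma3_c3 / 4)) {0..1}"
  proof -
    define F where "F = (\<lambda>x. Gamma3_c1 * (x ^ 2 / 2) + Gamma3_c2 * (x ^ 3 / 3) + Gamma3_c3 * (x ^ 4 / 4))"
    have "((\<lambda>x. Gamma3_c1 * x + Gamma3_c2 * x ^ 2 + Gamma3_c3 * x ^ 3) has_integral (F 1 - F 0)) {0..1}"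
    proof (rule fundamental_theorem_of_calculus)
      show "(F has_vector_derivative Gamma3_c1 * x + Gamma3_c2 * x ^ 2 + Gamma3_c3 * x ^ 3) (at x within {0..1})" for x
        unfolding F_def has_real_derivative_iff_has_vector_derivative[symmetric]
        by (rule derivative_eq_intros refl | (simp; fail))+
    qed auto
    thus ?thesis by (simp add: F_def)
  qed
  show "((\<lambda>x :: real. ln (barnes_Gamma3 (x + 1))) has_integral
     (Gamma3_c1 / 2 + Gamma3_c2 / 3 + Gamma3_c3 / 4 + (\<Sum>n. integral_ln_Gamma3_factor (Suc n)))) {0..1}"
    by (rule has_integral_eq[OF _ has_integral_add[OF poly *(1)]]) (simp add: ln_barnes_Gamma3)
qed

text \<open>
  Each summand is \<open>Bernoulli3_integral k / 2 - k (k + 1) (ln (k + 1) - ln k) / 4\<close> plus rational terms; the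
  sum of the products with logarithms is transformed by summation by parts. The constant \<open>1 / 24\<close> is
  \<open>Bernoulli3_integral 0 / 2\<close>, since the sum on the right starts at \<open>k = 0\<close>.
\<close>
lemma sum_integral_ln_Gamma3_factor:
  "(\<Sum>n<N. integral_ln_Gamma3_factor (Suc n)) =
     (\<Sum>k<Suc N. Bernoulli3_integral k) / 2 - 1 / 24 + real N * (real N + 2) / 8 - harm N / 24
     + (\<Sum>n<N. 1 / real (Suc n) ^ 2) / 24
     - real N * (real N + 1) * ln (real N + 1) / 4 + (\<Sum>n=1..N. real n * ln (real n)) / 2"
proof (induction N)
  case 0
  show ?case by (simp add: Bernoulli3_integral_def harm_def)
next
  case (Suc N)
  define M where "M = real N + 1"
  have M: "M > 0" "real (Suc N) = M" by (simp_all add: M_def)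
  have U: "integral_ln_Gamma3_factor (Suc N) = Bernoulli3_integral (Suc N) / 2 + M / 4 + 1 / 8
      - inverse M / 24 + 1 / M ^ 2 / 24 - M * (M + 1) * (ln (M + 1) - ln M) / 4"
    unfolding integral_ln_Gamma3_factor_def Bernoulli3_integral_def M(2)
    using M(1) by (simp add: field_simps power2_eq_square)
  have H: "harm (Suc N) = harm N + inverse M" by (simp add: harm_Suc M_def add.commute)
  have P: "(\<Sum>n=1..Suc N. real n * ln (real n)) = (\<Sum>n=1..N. real n * ln (real n)) + M * ln M"
    by (simp add: M_def add.commute)
  have N: "real N = M - 1" "M - 1 + 1 = M" by (simp_all add: M_def)
  show ?case
    unfolding sum.lessThan_Suc[of Bernoulli3_integral "Suc N"] sum.lessThan_Suc[of "\<lambda>n. 1 / real (Suc n) ^ 2" N]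
      sum.lessThan_Suc[of "\<lambda>n. integral_ln_Gamma3_factor (Suc n)" N] Suc.IH U H P M(2)
    unfolding N
    by (simp add: algebra_simps add_divide_distrib diff_divide_distrib power2_eq_square del: sum.lessThan_Suc)
qed

lemma suminf_integral_ln_Gamma3_factor:
  "(\<Sum>n. integral_ln_Gamma3_factor (Suc n)) =
     3 / (8 * pi\<^sup>2) * Re (riemann_zeta 3) + Re (riemann_zeta 2) / 24 + ln glaisher_kinkelin / 2
       - euler_mascheroni / 24 - 1 / 6"
proof -
  define P where "P = (\<lambda>N. \<Sum>n=1..N. real n * ln (real n))"
  define p where "p = (\<lambda>N. P N - (real N ^ 2 / 2 + real N / 2 + 1 / 12) * ln (real N) + real N ^ 2 / 4)"
  \<comment> \<open>what remains after the main terms of the three limits have been combined\<close>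
  define \<rho> where "\<rho> = (\<lambda>N. real N * (real N + 2) / 8 - real N * (real N + 1) * ln (real N + 1) / 4
    + ((real N ^ 2 / 2 + real N / 2 + 1 / 12) * ln (real N) - real N ^ 2 / 4) / 2 - ln (real N) / 24)"
  have zeta3: "(\<Sum>n. 1 / real (Suc n) ^ 3) = Re (riemann_zeta 3)"
    using Re_riemann_zeta_sums[of 3] by (simp add: sums_iff)
  have zeta2: "(\<lambda>n. 1 / real (Suc n) ^ 2) sums Re (riemann_zeta 2)"
    using Re_riemann_zeta_sums[of 2] by simp
  have "(\<lambda>N. \<Sum>n<N. integral_ln_Gamma3_factor (Suc n)) \<longlonglongrightarrow> (\<Sum>n. integral_ln_Gamma3_factor (Suc n))"
    using summable_integral_ln_Gamma3_factor by (rule summable_LIMSEQ)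
  moreover have "(\<lambda>N. \<Sum>n<N. integral_ln_Gamma3_factor (Suc n)) \<longlonglongrightarrow>
     3 / (4 * pi\<^sup>2) * Re (riemann_zeta 3) / 2 - 1 / 24 - euler_mascheroni / 24 + Re (riemann_zeta 2) / 24
       + ln glaisher_kinkelin / 2 + (- 1 / 8)"
  proof -
    have 1: "(\<lambda>N. \<Sum>k<Suc N. Bernoulli3_integral k) \<longlonglongrightarrow> 3 / (4 * pi\<^sup>2) * Re (riemann_zeta 3)"
      using LIMSEQ_Suc[OF sum_Bernoulli3_integral_LIMSEQ] unfolding zeta3 .
    have 2: "p \<longlonglongrightarrow> ln glaisher_kinkelin"
      unfolding p_def P_def by (rule LIMSEQ_imp_Suc[OF ln_glaisher_kinkelin_LIMSEQ])
    have 3: "\<rho> \<longlonglongrightarrow> - 1 / 8"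
    proof -
      \<comment> \<open>the terms in \<open>ln N\<close> cancel once \<open>ln (N + 1)\<close> is split\<close>
      have "(\<lambda>N. real N / 4 - real N * (real N + 1) / 4 * ln (1 + 1 / real N)) \<longlonglongrightarrow> - 1 / 8"
        by real_asymp
      moreover have "\<forall>\<^sub>F N in sequentially.
          real N / 4 - real N * (real N + 1) / 4 * ln (1 + 1 / real N) = \<rho> N"
        using eventually_gt_at_top[of 0]
      proof eventually_elim
        case (elim N)
        have "1 + 1 / real N = (real N + 1) / real N" using elim by (simp add: field_simps)
        hence "ln (1 + 1 / real N) = ln (real N + 1) - ln (real N)" using elim by (simp add: ln_div)
        show ?case unfolding \<open>ln (1 + 1 / real N) = _\<close> by (simp add: \<rho>_def field_simps power2_eq_square)
      qed
      ultimately show ?thesis by (rule Lim_transform_eventually)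
    qed
    have 4: "(\<lambda>N. harm N - ln (real N)) \<longlonglongrightarrow> (euler_mascheroni :: real)"
      using euler_mascheroni_LIMSEQ by simp
    have 5: "(\<lambda>N. \<Sum>n<N. 1 / real (Suc n) ^ 2) \<longlonglongrightarrow> Re (riemann_zeta 2)"
      using zeta2 by (simp only: sums_def)
    have "(\<Sum>n<N. integral_ln_Gamma3_factor (Suc n)) =
       (\<Sum>k<Suc N. Bernoulli3_integral k) / 2 - 1 / 24 - (harm N - ln (real N)) / 24
         + (\<Sum>n<N. 1 / real (Suc n) ^ 2) / 24 + p N / 2 + \<rho> N" for N
      unfolding sum_integral_ln_Gamma3_factor p_def \<rho>_def P_def
      by (simp add: field_simps del: sum.lessThan_Suc)
    moreover have "(\<lambda>N. (\<Sum>k<Suc N. Bernoulli3_integral k) / 2 - 1 / 24 - (harm N - ln (real N)) / 24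
         + (\<Sum>n<N. 1 / real (Suc n) ^ 2) / 24 + p N / 2 + \<rho> N) \<longlonglongrightarrow>
     3 / (4 * pi\<^sup>2) * Re (riemann_zeta 3) / 2 - 1 / 24 - euler_mascheroni / 24 + Re (riemann_zeta 2) / 24
       + ln glaisher_kinkelin / 2 + (- 1 / 8)"
      by (intro tendsto_intros 1 2 3 4 5) auto
    ultimately show ?thesis by simp
  qed
  ultimately have "(\<Sum>n. integral_ln_Gamma3_factor (Suc n)) =
     3 / (4 * pi\<^sup>2) * Re (riemann_zeta 3) / 2 - 1 / 24 - euler_mascheroni / 24 + Re (riemann_zeta 2) / 24
       + ln glaisher_kinkelin / 2 + (- 1 / 8)"
    by (rule LIMSEQ_unique)
  thus ?thesis by simp
qed

theorem mainTheorem6: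
  shows "((\<lambda>x :: real. ln (barnes_Gamma3 (x + 1))) has_integral
           (- 1 / 24 * ln (2 * pi) + 3 * Re (riemann_zeta 3) / (8 * pi ^ 2))) {0..1}"
proof -
  have "Gamma3_c1 / 2 + Gamma3_c2 / 3 + Gamma3_c3 / 4 + (\<Sum>n. integral_ln_Gamma3_factor (Suc n)) =
     - 1 / 24 * ln (2 * pi) + 3 * Re (riemann_zeta 3) / (8 * pi ^ 2)"
    unfolding suminf_integral_ln_Gamma3_factor Gamma3_c1_def Gamma3_c2_def Gamma3_c3_def
    by (simp add: field_simps)
  with has_integral_ln_barnes_Gamma3 show ?thesis by simp
qed

end
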